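(* Let $N\ge1$, $\gamma\in(0,1/2)$, and let $\mathbf v:\mathbb R\to[0,+\infty)$ be a smooth convex function whose derivative $\mathbf v'$ is globally Lipschitz. Let $(X_t,t\ge0)$ be the generalized Dyson Brownian motion on $\overline{\mathscr O}$ defined in the context, and let $\mathscr U$ be a nonempty open subset of $\overline{\mathscr O}$ (for the topology induced by $\mathbb R^N$) such that $\mathscr O\cap\mathscr U$ is connected. Then, for all $t>0$, the killed semigroup operator $P^{\mathscr U}_t$ is topologically irreducible, i.e. for all $t>0$, all $x,y\in\mathscr U$ and all $r>0$, $$\mathbb P_x\big[X_t\in\mathsf B_{\overline{\mathscr O}}(y,r),\ t<\sigma_{\mathscr U}\big]>0.$$
   Context: $\mathscr O=\{x=(x^1,\dots,x^N)\in\mathbb R^N: x^1<\dots<x^N\}$, with closure $\overline{\mathscr O}$ in $\mathbb R^N$. $V_c(x)=\sum_{k=1}^N\mathbf v(x^k)$ for $x\in\mathbb R^N$. $V_I(x)=-\gamma\sum_{1\le i<j\le N}\ln(x^j-x^i)$ if $x\in\mathscr O$ and $V_I(x)=+\infty$ otherwise; $V_I$ is a proper lower semicontinuous convex function whose subdifferential $\partial V_I$ is a single-valued maximal monotone operator with domain $\mathscr O$, i.e. its graph is $\mathrm{Gr}(\partial V_I)=\{(a,\nabla V_I(a)):a\in\mathscr O\}$. Let $(B_t)_{t\ge0}$ be a standard Brownian motion in $\mathbb R^N$ on a filtered probability space satisfying the usual conditions. For every $x\in\overline{\mathscr O}$ there is (known fact) a unique strong continuous solution $((X_t(x),K_t(x)),t\ge0)$,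 with $X_0(x)=x$, of $$dX_t=-\nabla V_c(X_t)\,dt-dK_t+dB_t$$ such that: (1) $(K_t)$ has finite variation and $K_0=0$; (2) $X_t\in\overline{\mathscr O}$ for all $t\ge0$; (3) for every continuous process $(\alpha,\beta)$ with $(\alpha_s,\beta_s)\in\mathrm{Gr}(\partial V_I)$ for all $s\ge0$, the measure $\langle X_s-\alpha_s,dK_s-\beta_s\,ds\rangle$ is a.s. nonnegative on $\mathbb R_+$. $\mathbb P_x,\mathbb E_x$ refer to $X_0=x$. $\sigma_{\mathscr U}=\inf\{t\ge0: X_t\notin\mathscr U\}$ is the first exit time from $\mathscr U$, and $P^{\mathscr U}_tf(x)=\mathbb E_x[f(X_t)\mathbf 1_{t<\sigma_{\mathscr U}}]$ for $f$ bounded Borel on $\mathscr U$, $x\in\mathscr U$. $\mathsf B_{\overline{\mathscr O}}(y,r)=\{z\in\overline{\mathscr O}:|z-y|<r\}$. *)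

theory Defs
  imports "HOL-Probability.Probability"
begin

text \<open>
  The coordinates of \<open>\<real>\<^sup>N\<close> are indexed by an arbitrary finite linearly ordered type \<open>'n\<close> with
  \<open>N\<close> elements, so that \<open>i < j\<close> makes sense for indices.
\<close>

definition chamber :: "(real ^ 'n::{finite,linorder}) set" where
  "chamber = {x. \<forall>i j. i < j \<longrightarrow> x $ i < x $ j}"

definition confining_potential :: "(real \<Rightarrow> real) \<Rightarrow> real ^ 'n::finite \<Rightarrow> real" where
  "confining_potential v x = (\<Sum>k\<in>UNIV. v (x $ k))"

definition interaction_potential :: "real \<Rightarrow> real ^ 'n::{finite,linorder} \<Rightarrow> ereal" where
  "interaction_potential \<gamma> x =
     (if x \<in> chamber then ereal (- \<gamma> * (\<Sum>(i, j)\<in>{(i, j). i < j}. ln (x $ j - x $ i))) else \<infinity>)"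

definition gradient :: "('a::real_inner \<Rightarrow> real) \<Rightarrow> 'a \<Rightarrow> 'a" where
  "gradient f x = (THE D. GDERIV f x :> D)"

definition subdifferential :: "('a::real_inner \<Rightarrow> ereal) \<Rightarrow> 'a \<Rightarrow> 'a set" where
  "subdifferential \<phi> a = {b. \<phi> a \<noteq> \<infinity> \<and> (\<forall>z. \<phi> a + ereal (b \<bullet> (z - a)) \<le> \<phi> z)}"

definition subdifferential_graph :: "('a::real_inner \<Rightarrow> ereal) \<Rightarrow> ('a \<times> 'a) set" where
  "subdifferential_graph \<phi> = {(a, b). b \<in> subdifferential \<phi> a}"

lemma gradient_eqI:
  assumes "GDERIV f x :> D"
  shows "gradient f x = D"
  unfolding gradient_def
proof (rule the_equality)
  show "GDERIV f x :> D" by (rule assms)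
next
  fix D' assume "GDERIV f x :> D'"
  with assms have "(\<lambda>h. h \<bullet> D') = (\<lambda>h. h \<bullet> D)"
    unfolding gderiv_def by (rule has_derivative_unique[rotated])
  then have "h \<bullet> D' = h \<bullet> D" for h
    by metis
  then show "D' = D"
    by (metis inner_commute vector_eq_ldot)
qed

lemma gradient_confining_potential:
  fixes x :: "real ^ 'n::finite"
  assumes "\<And>y. v differentiable (at y)"
  shows "gradient (confining_potential v) x = (\<chi> k. deriv v (x $ k))"
proof (rule gradient_eqI)
  have v: "(v has_field_derivative deriv v y) (at y)" for y
    using assms by (simp add: DERIV_deriv_iff_real_differentiable)
  have c: "((\<lambda>x. x $ k) has_derivative (\<lambda>h. h $ k)) (at x)" for k
    by (rule bounded_linear_imp_has_derivative) (rule bounded_linear_vec_nth)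
  have "((\<lambda>x. v (x $ k)) has_derivative (\<lambda>h. deriv v (x $ k) * h $ k)) (at x)" for k
    using has_derivative_compose[OF c[of k] v[of "x $ k", unfolded has_field_derivative_def]] by simp
  then have "((\<lambda>x. \<Sum>k\<in>UNIV. v (x $ k)) has_derivative
      (\<lambda>h. \<Sum>k\<in>UNIV. deriv v (x $ k) * h $ k)) (at x)"
    by (intro has_derivative_sum) auto
  then show "GDERIV (confining_potential v) x :> (\<chi> k. deriv v (x $ k))"
    unfolding gderiv_def confining_potential_def[abs_def]
    by (simp add: inner_vec_def mult.commute)
qed

lemma open_chamber: "open (chamber :: (real ^ 'n::{finite,linorder}) set)"
proof -
  have "chamber = (\<Inter>i. \<Inter>j\<in>{j. i < j}. {x :: real ^ 'n::{finite,linorder}. x $ i < x $ j})"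
    by (auto simp: chamber_def)
  also have "open \<dots>"
    by (intro open_INT finite ballI open_Collect_less continuous_intros)
  finally show ?thesis .
qed

lemma subdifferential_graph_interaction_potential:
  fixes \<gamma> :: real
  defines "V \<equiv> interaction_potential \<gamma> :: real ^ 'n::{finite,linorder} \<Rightarrow> ereal"
  assumes "\<gamma> > 0"
  shows "subdifferential_graph V
    = {(a, gradient (\<lambda>x. real_of_ereal (V x)) a) | a. a \<in> chamber}"
proof -
  define P where "P = {(i, j). i < (j::'n::{finite,linorder})}"
  define W where "W x = - \<gamma> * (\<Sum>p\<in>P. ln (x $ snd p - x $ fst p))" for x :: "real ^ 'n::{finite,linorder}"
  define W' where "W' a h = - \<gamma> * (\<Sum>p\<in>P. (h $ snd p - h $ fst p) / (a $ snd p - a $ fst p))"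
    for a h :: "real ^ 'n::{finite,linorder}"
  define G where "G a = (\<chi> k. W' a (axis k 1))" for a
  have V: "V x = (if x \<in> chamber then ereal (W x) else \<infinity>)" for x
    by (simp add: V_def W_def interaction_potential_def P_def case_prod_unfold)
  have pos: "a $ snd p - a $ fst p > 0" if "a \<in> chamber" "p \<in> P" for a p
    using that by (auto simp: chamber_def P_def)
  have dW: "(W has_derivative W' a) (at a)" if a: "a \<in> chamber" for a
  proof -
    have c: "((\<lambda>x. x $ k) has_derivative (\<lambda>h. h $ k)) (at a)" for k
      by (rule bounded_linear_imp_has_derivative) (rule bounded_linear_vec_nth)
    have "((\<lambda>x. ln (x $ snd p - x $ fst p)) has_derivative
        (\<lambda>h. (h $ snd p - h $ fst p) / (a $ snd p - a $ fst p))) (at a)" if "p \<in> P" for p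
      using pos[OF a that]
      by (auto intro!: derivative_eq_intros c simp: divide_simps mult.commute)
    then show ?thesis
      unfolding W_def[abs_def] W'_def[abs_def]
      by (intro has_derivative_mult_right has_derivative_sum) auto
  qed
  have inner_G: "h \<bullet> G a = W' a h" if a: "a \<in> chamber" for a h
  proof -
    interpret W': linear "W' a"
      by (rule has_derivative_linear[OF dW[OF a]])
    have "W' a h = W' a (\<Sum>k\<in>UNIV. h $ k *\<^sub>R axis k 1)"
      by (simp add: basis_expansion flip: scalar_mult_eq_scaleR)
    also have "\<dots> = h \<bullet> G a"
      by (simp add: W'.sum W'.scaleR G_def inner_vec_def)
    finally show ?thesis ..
  qed
  have grad: "gradient (\<lambda>x. real_of_ereal (V x)) a = G a" if a: "a \<in> chamber" for a
  proof (rule gradient_eqI)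
    have "(W has_derivative (\<lambda>h. h \<bullet> G a)) (at a)"
      using dW[OF a] inner_G[OF a] by simp
    then have "((\<lambda>x. real_of_ereal (V x)) has_derivative (\<lambda>h. h \<bullet> G a)) (at a)"
      by (rule has_derivative_transform_within_open[OF _ open_chamber a]) (simp add: V)
    then show "GDERIV (\<lambda>x. real_of_ereal (V x)) a :> G a"
      by (simp add: gderiv_def)
  qed
  have sub: "W a + W' a (z - a) \<le> W z" if a: "a \<in> chamber" and z: "z \<in> chamber" for a z
  proof -
    have "ln (z $ snd p - z $ fst p) \<le> ln (a $ snd p - a $ fst p)
        + ((z - a) $ snd p - (z - a) $ fst p) / (a $ snd p - a $ fst p)" if "p \<in> P" for p
    proof -
      define s t where "s = a $ snd p - a $ fst p" and "t = z $ snd p - z $ fst p"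
      have "s > 0" "t > 0"
        using pos a z that by (auto simp: s_def t_def)
      then have "ln t - ln s \<le> t / s - 1"
        using ln_le_minus_one[of "t / s"] by (simp add: ln_div)
      also have "t / s - 1 = ((z - a) $ snd p - (z - a) $ fst p) / s"
        using \<open>s > 0\<close> by (simp add: s_def t_def field_simps)
      finally show ?thesis
        by (simp add: s_def t_def)
    qed
    then have "(\<Sum>p\<in>P. ln (z $ snd p - z $ fst p)) \<le> (\<Sum>p\<in>P. ln (a $ snd p - a $ fst p))
        + (\<Sum>p\<in>P. ((z - a) $ snd p - (z - a) $ fst p) / (a $ snd p - a $ fst p))"
      by (subst sum.distrib[symmetric]) (rule sum_mono)
    from mult_left_mono[OF this, of \<gamma>] \<open>\<gamma> > 0\<close> show ?thesis
      by (simp add: W_def W'_def algebra_simps)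
  qed
  have "b \<in> subdifferential V a \<longleftrightarrow> a \<in> chamber \<and> b = G a" for a b
  proof
    assume b: "b \<in> subdifferential V a"
    then have a: "a \<in> chamber"
      by (auto simp: subdifferential_def V split: if_splits)
    have min: "W a - b \<bullet> a \<le> W z - b \<bullet> z" if "z \<in> chamber" for z
      using b that a by (auto simp: subdifferential_def V inner_diff_right dest!: spec[of _ z])
    have "((\<lambda>z. W z - b \<bullet> z) has_derivative (\<lambda>h. h \<bullet> G a - b \<bullet> h)) (at a)"
      using dW[OF a] inner_G[OF a] by (auto intro!: derivative_eq_intros)
    then have "(\<lambda>h. h \<bullet> G a - b \<bullet> h) = (\<lambda>h. 0)"
      by (rule differential_zero_maxmin[OF a open_chamber]) (use min in auto)
    then have "h \<bullet> G a = b \<bullet> h" for h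
      by (metis eq_iff_diff_eq_0)
    then have "b = G a"
      by (metis inner_commute vector_eq_ldot)
    with a show "a \<in> chamber \<and> b = G a"
      by simp
  next
    assume "a \<in> chamber \<and> b = G a"
    then show "b \<in> subdifferential V a"
      using sub[of a] inner_G[of a, symmetric]
      by (auto simp: subdifferential_def V inner_commute[of "G a"])
  qed
  then show ?thesis
    using grad by (auto simp: subdifferential_graph_def)
qed

definition total_variation :: "(real \<Rightarrow> 'a::real_normed_vector) \<Rightarrow> real \<Rightarrow> real \<Rightarrow> ennreal" where
  "total_variation g a b =
     (SUP D\<in>{D. D division_of {a..b}}. ennreal (\<Sum>k\<in>D. norm (g (Sup k) - g (Inf k))))"

definition finite_variation :: "(real \<Rightarrow> 'a::real_normed_vector) \<Rightarrow> bool" where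
  "finite_variation g \<longleftrightarrow> (\<forall>T\<ge>0. total_variation g 0 T < \<infinity>)"

text \<open>
  For \<open>g\<close> right-continuous and of finite variation on \<open>[0, \<infinity>)\<close>, let \<open>v\<close> be its total variation on
  \<open>[0, t]\<close> (which is \<open>0\<close> for \<open>t < 0\<close>, as then \<open>{0..t} = {}\<close>). Both \<open>v\<close> and \<open>v - (g - g 0)\<close> are
  nondecreasing, and \<open>dg = dv - d(v - (g - g 0))\<close>. The extension of \<open>g\<close> by the constant \<open>g 0\<close> to
  negative times means that \<open>dg\<close> has no atom at \<open>0\<close>.
\<close>

definition stieltjes_integral :: "(real \<Rightarrow> real) \<Rightarrow> real set \<Rightarrow> (real \<Rightarrow> real) \<Rightarrow> real" where
  "stieltjes_integral g A f =
     (let v = (\<lambda>t. enn2real (total_variation g 0 t)) in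
       (LINT s:A|interval_measure v. f s)
       - (LINT s:A|interval_measure (\<lambda>t. v t - (g (max 0 t) - g 0)). f s))"

text \<open>The signed measure \<open>\<langle>y\<^sub>s, dk\<^sub>s - \<beta>\<^sub>s ds\<rangle>\<close>. On the half-line it is a signed Radon measure, which
  in general has finite values on bounded Borel sets only; nonnegativity is tested on these.\<close>

definition pairing_measure ::
  "(real \<Rightarrow> real ^ 'n::finite) \<Rightarrow> (real \<Rightarrow> real ^ 'n) \<Rightarrow> (real \<Rightarrow> real ^ 'n) \<Rightarrow> real set \<Rightarrow> real" where
  "pairing_measure y k \<beta> A =
     (\<Sum>i\<in>UNIV. stieltjes_integral (\<lambda>s. k s $ i) A (\<lambda>s. y s $ i))
     - (LINT s:A|lborel. y s \<bullet> \<beta> s)"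

definition nonneg_on_half_line :: "(real set \<Rightarrow> real) \<Rightarrow> bool" where
  "nonneg_on_half_line \<mu> \<longleftrightarrow> (\<forall>A\<in>sets borel. A \<subseteq> {0..} \<and> bounded A \<longrightarrow> 0 \<le> \<mu> A)"

text \<open>The time set is \<open>[0, \<infinity>)\<close>; values of filtrations and processes at negative times are
  irrelevant throughout.\<close>

definition usual_filtration :: "'w measure \<Rightarrow> (real \<Rightarrow> 'w measure) \<Rightarrow> bool" where
  "usual_filtration M F \<longleftrightarrow>
     complete_measure M \<and>
     (\<forall>t\<ge>0. subalgebra M (F t)) \<and>
     (\<forall>s t. 0 \<le> s \<and> s \<le> t \<longrightarrow> sets (F s) \<subseteq> sets (F t)) \<and>
     null_sets M \<subseteq> sets (F 0) \<and>
     (\<forall>t\<ge>0. sets (F t) = (\<Inter>s\<in>{t<..}. sets (F s)))"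

definition adapted_process ::
  "(real \<Rightarrow> 'w measure) \<Rightarrow> (real \<Rightarrow> 'w \<Rightarrow> 'a::topological_space) \<Rightarrow> bool" where
  "adapted_process F Y \<longleftrightarrow> (\<forall>t\<ge>0. Y t \<in> borel_measurable (F t))"

definition brownian_motion ::
  "'w measure \<Rightarrow> (real \<Rightarrow> 'w measure) \<Rightarrow> (real \<Rightarrow> 'w \<Rightarrow> real ^ 'n::finite) \<Rightarrow> bool" where
  "brownian_motion M F B \<longleftrightarrow>
     adapted_process F B \<and>
     (AE \<omega> in M. B 0 \<omega> = 0) \<and>
     (AE \<omega> in M. continuous_on {0..} (\<lambda>t. B t \<omega>)) \<and>
     (\<forall>s t. 0 \<le> s \<and> s < t \<longrightarrow>
        distributed M lborel (\<lambda>\<omega>. B t \<omega> - B s \<omega>)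
          (\<lambda>z. ennreal (\<Prod>i\<in>UNIV. normal_density 0 (sqrt (t - s)) (z $ i))) \<and>
        prob_space.indep_set M (sets (F s))
          (sets (vimage_algebra (space M) (\<lambda>\<omega>. B t \<omega> - B s \<omega>) borel)))"

text \<open>
  A strong solution started at \<open>x\<close> of \<open>dX = - \<nabla>V\<^sub>c(X) dt - dK + dB\<close>, in the sense of multivalued
  stochastic differential equations: the pair \<open>(X, K)\<close> lives on the given filtered space, is driven
  by the given \<open>B\<close>, and the noise being additive, the equation is a pathwise integral equation.
\<close>

definition generalized_dyson_solution ::
  "(real \<Rightarrow> real) \<Rightarrow> real \<Rightarrow> 'w measure \<Rightarrow> (real \<Rightarrow> 'w measure) \<Rightarrow>
   (real \<Rightarrow> 'w \<Rightarrow> real ^ 'n::{finite,linorder}) \<Rightarrow> real ^ 'n::{finite,linorder} \<Rightarrow>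
   (real \<Rightarrow> 'w \<Rightarrow> real ^ 'n::{finite,linorder}) \<Rightarrow> (real \<Rightarrow> 'w \<Rightarrow> real ^ 'n::{finite,linorder}) \<Rightarrow> bool" where
  "generalized_dyson_solution v \<gamma> M F B x X K \<longleftrightarrow>
     adapted_process F X \<and> adapted_process F K \<and>
     (AE \<omega> in M. continuous_on {0..} (\<lambda>t. X t \<omega>) \<and> continuous_on {0..} (\<lambda>t. K t \<omega>)) \<and>
     (AE \<omega> in M. X 0 \<omega> = x) \<and>
     (AE \<omega> in M. \<forall>t\<ge>0.
        X t \<omega> = x - integral {0..t} (\<lambda>s. gradient (confining_potential v) (X s \<omega>))
                - K t \<omega> + B t \<omega>) \<and>
     (AE \<omega> in M. finite_variation (\<lambda>t. K t \<omega>) \<and> K 0 \<omega> = 0) \<and>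
     (AE \<omega> in M. \<forall>t\<ge>0. X t \<omega> \<in> closure chamber) \<and>
     (\<forall>\<alpha> \<beta> :: real \<Rightarrow> 'w \<Rightarrow> real ^ 'n::{finite,linorder}.
        (\<forall>s\<ge>0. \<alpha> s \<in> borel_measurable M \<and> \<beta> s \<in> borel_measurable M) \<and>
        (\<forall>\<omega>\<in>space M. continuous_on {0..} (\<lambda>s. \<alpha> s \<omega>) \<and> continuous_on {0..} (\<lambda>s. \<beta> s \<omega>)) \<and>
        (\<forall>\<omega>\<in>space M. \<forall>s\<ge>0.
           (\<alpha> s \<omega>, \<beta> s \<omega>) \<in> subdifferential_graph (interaction_potential \<gamma>)) \<longrightarrow>
        (AE \<omega> in M. nonneg_on_half_line
           (pairing_measure (\<lambda>s. X s \<omega> - \<alpha> s \<omega>) (\<lambda>s. K s \<omega>) (\<lambda>s. \<beta> s \<omega>))))"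

definition exit_time :: "'a set \<Rightarrow> (real \<Rightarrow> 'a) \<Rightarrow> ereal" where
  "exit_time U \<xi> = Inf (ereal ` {t. 0 \<le> t \<and> \<xi> t \<notin> U})"

text \<open>\<open>X x\<close> is the process started at \<open>x\<close>, so integration of a functional of \<open>X x\<close> against \<open>M\<close> is
  the expectation \<open>\<bbbE>\<^sub>x\<close>. Only the values of \<open>f\<close> on \<open>U\<close> matter, since \<open>t < exit_time U \<xi>\<close> implies
  \<open>\<xi> t \<in> U\<close> for \<open>t \<ge> 0\<close>.\<close>

definition killed_semigroup ::
  "'w measure \<Rightarrow> ('a \<Rightarrow> real \<Rightarrow> 'w \<Rightarrow> 'a) \<Rightarrow> 'a set \<Rightarrow> real \<Rightarrow> ('a \<Rightarrow> real) \<Rightarrow> 'a \<Rightarrow> real" where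
  "killed_semigroup M X U t f x =
     (LINT \<omega>|M. f (X x t \<omega>) * indicator {\<omega>. ereal t < exit_time U (\<lambda>s. X x s \<omega>)} \<omega>)"

definition topologically_irreducible ::
  "'a::metric_space set \<Rightarrow> 'a set \<Rightarrow> (('a \<Rightarrow> real) \<Rightarrow> 'a \<Rightarrow> real) \<Rightarrow> bool" where
  "topologically_irreducible S U Q \<longleftrightarrow>
     (\<forall>x\<in>U. \<forall>y\<in>U. \<forall>r>0. 0 < Q (indicator (ball y r \<inter> S)) x)"

end

theory Submission
  imports Defs
begin

text \<open>
  The process follows, with positive probability, any prescribed continuous path \<open>\<alpha>\<close> in the open
  chamber, up to the initial gap between its starting point and \<open>\<alpha> 0\<close> and an arbitrarily small error.
  Irreducibility follows by choosing \<open>\<alpha>\<close> well: \<open>chamber \<inter> U\<close> is open and connected, and boundary points of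
  the chamber are reached by segments whose other points are interior, so some path runs in
  \<open>chamber \<inter> U\<close> from a point near \<open>x\<close> to a point near \<open>y\<close>, with a tube around it (relative to the
  closed chamber) inside \<open>U\<close>. The width of the tube is fixed before the endpoints are moved into
  the interior, so that the gap \<open>x - \<alpha> 0\<close> can be made small compared with it (\<open>tube_path\<close>).

  Tracking \<open>\<alpha>\<close> (\<open>dyson_tracks_path\<close>) combines a property of Brownian motion with one of the
  equation. Let \<open>J\<close> be the gradient of the full potential and let \<open>w\<close> be the noise that would drive the
  solution along \<open>\<alpha>\<close>, that is, \<open>w s = \<alpha> s - \<alpha> 0 + \<integral>\<^sub>0\<^sup>s J (\<alpha> r) dr\<close>. Brownian motion stays uniformly close
  to \<open>w\<close> with positive probability (\<open>full_support\<close>). On this event test the defining inequality of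
  the multivalued equation with the \<^emph>\<open>random\<close> path \<open>a = \<alpha> + (B - w)\<close>, truncated so that it never
  leaves the chamber, and with the gradient \<open>b\<close> of the interaction along \<open>a\<close>. The Brownian parts of \<open>X\<close> and \<open>a\<close> cancel, so
  \<open>Z = X - a\<close> has finite variation. The inequality controls \<open>\<langle>Z, dK\<rangle>\<close>, the convexity of \<open>v\<close> controls
  the confining drift, and what is left of \<open>d|Z|\<^sup>2\<close> is at most \<open>2 |Z| |J a - J \<alpha>| dt\<close>. The last factor is
  small because \<open>J\<close> is uniformly continuous near \<open>\<alpha>\<close>. Since the randomness is absorbed into the test
  path, \<open>K\<close> enters through its pairing with \<open>Z\<close> alone, even when \<open>X\<close> starts on the boundary, where
  the interaction is singular.

  Full support is obtained by a feedback argument. Divide time into \<open>n\<close> steps and require on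
  each step that every coordinate of the increment has the sign opposite to the current error,
  exceeds one standard deviation and has small oscillation. Since a standard deviation \<open>\<surd>h\<close> dominates
  the displacement \<open>m h\<close> of a Lipschitz target, the error stays
  bounded; since the probability of
  each step is bounded below whatever happened before, so is that of the whole event. Oscillation
  within a step is controlled by Ottaviani's inequality, which rests on the independence of single increments.
\<close>

section \<open>Total variation and Stieltjes integrals\<close>

lemma sum_le_total_variation:
  assumes "D division_of {a..b}"
  shows "ennreal (\<Sum>k\<in>D. norm (g (Sup k) - g (Inf k))) \<le> total_variation g a b"
  unfolding total_variation_def by (rule SUP_upper) (use assms in simp)

definition clip :: "real \<Rightarrow> real \<Rightarrow> real \<Rightarrow> real" where
  "clip c d x = max c (min d x)"

text \<open>
  Composing with a clip restricts a division of \<open>{a..b}\<close> to \<open>{c..d}\<close> without naming the restricted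
  division: pieces that miss \<open>{c..d}\<close> contribute nothing. This is how a single division of a
  long interval is compared with variations over subintervals.
\<close>

lemma sum_clip_le_total_variation:
  fixes g :: "real \<Rightarrow> 'a::real_normed_vector"
  assumes D: "D division_of {a..b}" and cd: "a \<le> c" "c \<le> d" "d \<le> b"
  shows "ennreal (\<Sum>k\<in>D. norm (g (clip c d (Sup k)) - g (clip c d (Inf k)))) \<le> total_variation g c d"
proof -
  let ?h = "\<lambda>k. norm (g (clip c d (Sup k)) - g (clip c d (Inf k)))"
  let ?f = "\<lambda>k. norm (g (Sup k) - g (Inf k))"
  let ?E = "{k\<in>D. {c..d} \<inter> k \<noteq> {}}"
  let ?D' = "(\<lambda>k. {c..d} \<inter> k) ` ?E"
  have fin: "finite D" using D by blast
  have form: "\<exists>p q. p \<le> q \<and> k = {p..q}" if "k \<in> D" for k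
    using division_ofD(3,4)[OF D that] by fastforce
  have D': "?D' division_of {c..d}"
  proof -
    have "{cbox c d \<inter> k | k. k \<in> D \<and> cbox c d \<inter> k \<noteq> {}} division_of cbox c d"
      by (rule division_inter_1[OF D]) (use cd in auto)
    moreover have "{cbox c d \<inter> k | k. k \<in> D \<and> cbox c d \<inter> k \<noteq> {}} = ?D'"
      by auto
    ultimately show ?thesis by simp
  qed
  have "(\<Sum>k\<in>D. ?h k) = (\<Sum>k\<in>?E. ?h k)"
  proof (rule sum.mono_neutral_right)
    show "\<forall>k\<in>D - ?E. ?h k = 0"
    proof
      fix k assume k: "k \<in> D - ?E"
      then obtain p q where pq: "p \<le> q" "k = {p..q}" using form by blast
      with k have "\<not> (\<exists>x. c \<le> x \<and> x \<le> d \<and> p \<le> x \<and> x \<le> q)" by force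
      then have "q < c \<or> d < p"
        using pq cd by (metis linorder_not_le order.refl linear)
      then show "?h k = 0" using pq cd by (auto simp: clip_def)
    qed
  qed (use fin in auto)
  also have "\<dots> = (\<Sum>k\<in>?E. ?f ({c..d} \<inter> k))"
  proof (rule sum.cong)
    fix k assume k: "k \<in> ?E"
    then obtain p q where pq: "p \<le> q" "k = {p..q}" using form by blast
    with k have "{c..d} \<inter> k = {max c p..min d q}" "max c p \<le> min d q" by auto
    moreover have "clip c d q = min d q" "clip c d p = max c p"
      using calculation pq by (auto simp: clip_def)
    ultimately show "?h k = ?f ({c..d} \<inter> k)" using pq by simp
  qed simp
  also have "\<dots> = (\<Sum>k\<in>?D'. ?f k)"
  proof (subst sum.reindex_nontrivial)
    fix k l assume kl: "k \<in> ?E" "l \<in> ?E" "k \<noteq> l" "{c..d} \<inter> k = {c..d} \<inter> l"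
    then have int: "interior k \<inter> interior l = {}" using division_ofD(5)[OF D] by blast
    obtain p q where pq: "p \<le> q" "k = {p..q}" using form kl by blast
    have ne: "{c..d} \<inter> k = {max c p..min d q}" "max c p \<le> min d q" using kl(1) pq by auto
    have "interior ({c..d} \<inter> k) \<subseteq> interior k \<inter> interior l"
      using kl(4) by (metis Int_greatest inf_le2 interior_mono)
    then have "{max c p<..<min d q} = {}" using int ne(1) by simp
    then have "max c p = min d q" using ne(2) greaterThanLessThan_empty_iff by force
    then show "?f ({c..d} \<inter> k) = 0" using ne by simp
  qed (use fin in auto)
  finally show ?thesis using sum_le_total_variation[OF D', of g] by simp
qed

lemma total_variation_superadditive:
  assumes "a \<le> b" "b \<le> c"
  shows "total_variation g a b + total_variation g b c \<le> total_variation g a c"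
proof -
  let ?f = "\<lambda>k. norm (g (Sup k) - g (Inf k))"
  have one: "ennreal (\<Sum>k\<in>D. ?f k) + ennreal (\<Sum>k\<in>E. ?f k) \<le> total_variation g a c"
    if D: "D division_of {a..b}" and E: "E division_of {b..c}" for D E
  proof -
    have DE: "D \<union> E division_of {a..b} \<union> {b..c}"
      by (rule division_disjoint_union[OF D E]) auto
    have "(\<Sum>k\<in>D \<union> E. ?f k) = (\<Sum>k\<in>D. ?f k) + (\<Sum>k\<in>E. ?f k)"
    proof (rule sum.union_inter_neutral)
      show "\<forall>k\<in>D \<inter> E. ?f k = 0"
      proof
        fix k assume k: "k \<in> D \<inter> E"
        then have "k \<noteq> {}" "k \<subseteq> {a..b}" "k \<subseteq> {b..c}"
          using division_ofD(2,3)[OF D, of k] division_ofD(2)[OF E, of k] by auto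
        then have "k = {b}" by force
        then show "?f k = 0" by simp
      qed
    qed (use D E in blast)+
    moreover have "{a..b} \<union> {b..c} = {a..c}" using assms by auto
    ultimately show ?thesis using sum_le_total_variation[of "D \<union> E" a c g] DE
      by (simp add: sum_nonneg flip: ennreal_plus)
  qed
  have ne: "{D. D division_of {x..y::real}} \<noteq> {}" for x y
    by (cases "x \<le> y") (use division_of_self[of x y] in \<open>auto simp: division_of_trivial\<close>)
  have "total_variation g a b + ennreal (\<Sum>k\<in>E. ?f k) \<le> total_variation g a c"
    if E: "E division_of {b..c}" for E
    unfolding total_variation_def[of g a b]
    by (subst ennreal_SUP_add_left[symmetric]) (use ne one[OF _ E] in \<open>auto intro!: SUP_least\<close>)
  then show ?thesis
    unfolding total_variation_def[of g b c]
    by (subst ennreal_SUP_add_right) (use ne in \<open>auto intro!: SUP_least\<close>)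
qed

lemma total_variation_refl [simp]: "total_variation g a a = 0"
proof -
  have "(\<Sum>k\<in>D. norm (g (Sup k) - g (Inf k))) = 0" if "D division_of {a..a}" for D
  proof (rule sum.neutral, rule)
    fix k assume "k \<in> D"
    then have "k \<noteq> {}" "k \<subseteq> {a..a}" using division_ofD(2,3)[OF that, of k] by auto
    then have "k = {a}" by force
    then show "norm (g (Sup k) - g (Inf k)) = 0" by simp
  qed
  then have "total_variation g a a \<le> 0" unfolding total_variation_def by (intro SUP_least) auto
  then show ?thesis by simp
qed

lemma total_variation_empty [simp]:
  assumes "b < a" shows "total_variation g a b = 0"
proof -
  have "{a..b} = {}" using assms by simp
  then show ?thesis unfolding total_variation_def by simp
qed

lemma norm_diff_le_total_variation:
  assumes "a \<le> b" shows "ennreal (norm (g b - g a)) \<le> total_variation g a b"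
proof -
  have "{{a..b}} division_of {a..b}" using division_of_self[of a b] assms by simp
  from sum_le_total_variation[OF this, of g] show ?thesis using assms by simp
qed

lemma total_variation_component_le:
  fixes g :: "real \<Rightarrow> real ^ 'n"
  shows "total_variation (\<lambda>s. g s $ i) a b \<le> total_variation g a b"
  unfolding total_variation_def
proof (rule SUP_mono)
  fix D assume "D \<in> {D. D division_of {a..b}}"
  moreover have "(\<Sum>k\<in>D. norm (g (Sup k) $ i - g (Inf k) $ i)) \<le> (\<Sum>k\<in>D. norm (g (Sup k) - g (Inf k)))"
    by (rule sum_mono) (use component_le_norm_cart[of "g (Sup k) - g (Inf k)" i for k] in auto)
  ultimately show "\<exists>E\<in>{D. D division_of {a..b}}. ennreal (\<Sum>k\<in>D. norm (g (Sup k) $ i - g (Inf k) $ i))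
      \<le> ennreal (\<Sum>k\<in>E. norm (g (Sup k) - g (Inf k)))"
    by (intro bexI[of _ D] ennreal_leI)
qed

lemma finite_variation_component:
  fixes g :: "real \<Rightarrow> real ^ 'n"
  assumes "finite_variation g"
  shows "finite_variation (\<lambda>s. g s $ i)"
  unfolding finite_variation_def
proof (intro allI impI)
  fix T :: real assume "0 \<le> T"
  then have "total_variation g 0 T < \<infinity>" using assms by (simp add: finite_variation_def)
  then show "total_variation (\<lambda>s. g s $ i) 0 T < \<infinity>"
    using total_variation_component_le[of g i 0 T] by (rule le_less_trans[rotated])
qed

context
  fixes g :: "real \<Rightarrow> real" and V :: "real \<Rightarrow> real"
  assumes fv: "finite_variation g" and cont: "continuous_on {0..} g"
  defines "V \<equiv> \<lambda>t. enn2real (total_variation g 0 t)"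
begin

lemma ennreal_variation: "ennreal (V t) = total_variation g 0 t"
proof -
  have "total_variation g 0 t < \<infinity>"
    using fv by (cases "t \<ge> 0") (auto simp: finite_variation_def)
  then show ?thesis by (simp add: V_def)
qed

lemma variation_nonneg: "0 \<le> V t" by (simp add: V_def)

lemma variation_neg: "t \<le> 0 \<Longrightarrow> V t = 0" by (cases "t = 0") (auto simp: V_def)

lemma variation_add_le:
  assumes "0 \<le> s" "s \<le> t"
  shows "ennreal (V s) + total_variation g s t \<le> ennreal (V t)"
  using total_variation_superadditive[of 0 s t g] assms by (simp add: ennreal_variation)

text \<open>
  Both the variation and its difference with \<open>g\<close> are therefore nondecreasing, hence distribution
  functions of measures.
\<close>

lemma variation_increment:
  assumes "0 \<le> s" "s \<le> t"
  shows "\<bar>g t - g s\<bar> \<le> V t - V s"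
proof -
  have "ennreal (V s + \<bar>g t - g s\<bar>) \<le> ennreal (V t)"
    using order_trans[OF add_left_mono[OF norm_diff_le_total_variation[OF assms(2), of g]] variation_add_le[OF assms]]
    by (simp add: variation_nonneg)
  then have "V s + \<bar>g t - g s\<bar> \<le> V t" using variation_nonneg by (simp del: ennreal_plus)
  then show ?thesis by simp
qed

lemma variation_mono: "s \<le> t \<Longrightarrow> V s \<le> V t"
  using variation_increment[of s t] variation_increment[of 0 t] variation_neg[of s] variation_nonneg[of t] by (cases "0 \<le> s") auto

text \<open>
  Take a division of \<open>{0..s + 1}\<close> that nearly attains the total variation and split each of its
  increments at \<open>s\<close> and at \<open>t > s\<close>. The parts before \<open>s\<close> and after \<open>t\<close> are bounded by the variations
  there; each of the finitely many middle parts is an oscillation of \<open>g\<close> over \<open>{s..t}\<close>, which is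
  small by continuity. So the variation over \<open>{s..t}\<close> is small.
\<close>

lemma variation_right_continuous: "continuous (at_right s) V"
proof (cases "s < 0")
  case True
  have "\<forall>\<^sub>F t in at_right s. 0 = V t"
    using eventually_at_right_real[OF True] by eventually_elim (simp add: variation_neg)
  then have "(V \<longlongrightarrow> 0) (at_right s)" by (rule Lim_transform_eventually[OF tendsto_const])
  then show ?thesis using True by (simp add: continuous_within variation_neg)
next
  case False
  then have s: "0 \<le> s" by simp
  show ?thesis unfolding continuous_within
  proof (rule tendstoI)
    fix e :: real assume e: "e > 0"
    define T where "T = s + 1"
    have "ennreal (V T - e / 2) < total_variation g 0 T \<or> V T = 0"
      using e variation_nonneg[of T] by (auto simp: ennreal_variation[symmetric] ennreal_less_iff ennreal_lessI)
    then obtain D where D: "D division_of {0..T}"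
      and D_sum: "V T - e / 2 < (\<Sum>k\<in>D. norm (g (Sup k) - g (Inf k)))"
    proof
      assume "V T = 0"
      moreover have "{{0..T}} division_of {0..T}" using division_of_self[of 0 T] s by (simp add: T_def)
      moreover have "V T - e / 2 < (\<Sum>k\<in>{{0..T}}. norm (g (Sup k) - g (Inf k)))"
        using \<open>V T = 0\<close> e by (auto intro: less_le_trans)
      ultimately show ?thesis using that by blast
    next
      assume "ennreal (V T - e / 2) < total_variation g 0 T"
      then obtain D where "D division_of {0..T}"
        "ennreal (V T - e / 2) < ennreal (\<Sum>k\<in>D. norm (g (Sup k) - g (Inf k)))"
        unfolding total_variation_def less_SUP_iff by auto
      moreover have "V T - e / 2 < (\<Sum>k\<in>D. norm (g (Sup k) - g (Inf k)))"
        using calculation(2) ennreal_leI linorder_not_le by metis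
      ultimately show ?thesis using that by simp
    qed
    have fin: "finite D" using D by blast
    \<comment> \<open>Each piece of \<open>D\<close> costs at most \<open>2 c\<close>, and these costs must add up to at most \<open>e / 2\<close>.\<close>
    define c where "c = e / (4 * (real (card D) + 1))"
    have c: "c > 0" using e by (simp add: c_def)
    have "(g \<longlongrightarrow> g s) (at s within {0..})" using cont s by (simp add: continuous_on)
    then have "\<forall>\<^sub>F t in at s within {0..}. dist (g t) (g s) < c" using c by (rule tendstoD)
    then obtain \<delta> where \<delta>0: "\<delta> > 0"
      and \<delta>1: "\<forall>x\<in>{0..}. x \<noteq> s \<and> dist x s < \<delta> \<longrightarrow> dist (g x) (g s) < c"
      unfolding eventually_at by auto
    have \<delta>: "\<bar>g t - g s\<bar> \<le> c" if "t \<ge> 0" "\<bar>t - s\<bar> < \<delta>" for t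
      using \<delta>1[rule_format, of t] that c by (cases "t = s") (auto simp: dist_real_def)
    have main: "V t - V s < e" if t: "s < t" "t < s + min \<delta> 1" for t
    proof -
      let ?n = "\<lambda>a b k. norm (g (clip a b (Sup k)) - g (clip a b (Inf k)))"
      have tT: "t \<le> T" using t by (simp add: T_def)
      have "norm (g (Sup k) - g (Inf k)) \<le> ?n 0 s k + ?n t T k + 2 * c" if k: "k \<in> D" for k
      proof -
        obtain p q where pq: "p \<le> q" "k = {p..q}" "0 \<le> p" "q \<le> T"
          using division_ofD(2,3,4)[OF D k] by fastforce
        have split: "g x = g (clip 0 s x) + g (clip s t x) + g (clip t T x) - g s - g t"
          if "0 \<le> x" "x \<le> T" for x
          using that s t tT by (auto simp: clip_def max_def min_def)
        have "\<bar>g (clip s t x) - g s\<bar> \<le> c" for x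
          by (rule \<delta>) (use s t in \<open>auto simp: clip_def\<close>)
        from this[of p] this[of q] show ?thesis using pq split[of p] split[of q] by simp
      qed
      then have "(\<Sum>k\<in>D. norm (g (Sup k) - g (Inf k))) \<le> (\<Sum>k\<in>D. ?n 0 s k + ?n t T k + 2 * c)"
        by (rule sum_mono)
      also have "\<dots> = (\<Sum>k\<in>D. ?n 0 s k) + (\<Sum>k\<in>D. ?n t T k) + 2 * c * card D"
        by (simp add: sum.distrib)
      also have "(\<Sum>k\<in>D. ?n 0 s k) \<le> V s"
        using sum_clip_le_total_variation[OF D, of 0 s g] s t tT
        by (simp add: ennreal_variation[symmetric] variation_nonneg)
      also have "(\<Sum>k\<in>D. ?n t T k) \<le> V T - V t"
      proof -
        have "ennreal (V t + (\<Sum>k\<in>D. ?n t T k)) \<le> ennreal (V t) + total_variation g t T"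
          using sum_clip_le_total_variation[OF D, of t T g] s t tT
          by (simp add: variation_nonneg sum_nonneg add_left_mono)
        also have "\<dots> \<le> ennreal (V T)" by (rule variation_add_le) (use s t tT in auto)
        finally have "V t + (\<Sum>k\<in>D. ?n t T k) \<le> V T" using variation_nonneg[of T] by (simp del: ennreal_plus)
        then show ?thesis by simp
      qed
      finally have "V T - e / 2 < V s + (V T - V t) + 2 * c * card D" using D_sum by simp
      moreover have "2 * c * card D \<le> e / 2"
        using e by (simp add: c_def field_simps)
      ultimately show ?thesis by linarith
    qed
    have "\<forall>\<^sub>F t in at_right s. t < s + min \<delta> 1 \<and> s < t"
      by (rule eventually_at_rightI[of s "s + min \<delta> 1"]) (use \<delta>0 in auto)
    then show "\<forall>\<^sub>F t in at_right s. dist (V t) (V s) < e"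
    proof eventually_elim
      case (elim t) then show ?case using main[of t] variation_mono[of s t] by (simp add: dist_real_def)
    qed
  qed
qed

lemma variation_minus_mono: "s \<le> t \<Longrightarrow> V s - (g (max 0 s) - g 0) \<le> V t - (g (max 0 t) - g 0)"
  using variation_increment[of "max 0 s" "max 0 t"] variation_neg[of s] variation_neg[of t] variation_neg[of 0]
  by (cases "0 \<le> s"; cases "0 \<le> t") (auto simp: max_def)

lemma variation_minus_right_continuous: "continuous (at_right s) (\<lambda>t. V t - (g (max 0 t) - g 0))"
proof -
  have "continuous_on UNIV (\<lambda>t. g (max 0 t))"
    by (rule continuous_on_compose2[OF cont]) (auto intro!: continuous_intros)
  then have "continuous (at_right s) (\<lambda>t. g (max 0 t))"
    using continuous_on_eq_continuous_at continuous_at_imp_continuous_at_within by blast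
  then show ?thesis by (intro continuous_diff variation_right_continuous continuous_const)
qed

text \<open>
  The right continuity just established is what makes \<open>interval_measure\<close> give the half-open
  intervals their expected masses.
\<close>

lemma stieltjes_integral_as_difference:
  obtains \<mu> \<nu> :: "real measure" where "sets \<mu> = sets borel" "sets \<nu> = sets borel"
    "\<And>a b. a \<le> b \<Longrightarrow> emeasure \<mu> {a<..b} < \<infinity>" "\<And>a b. a \<le> b \<Longrightarrow> emeasure \<nu> {a<..b} < \<infinity>"
    "\<And>a b. 0 \<le> a \<Longrightarrow> a \<le> b \<Longrightarrow> measure \<mu> {a<..b} - measure \<nu> {a<..b} = g b - g a"
    "\<And>A f. stieltjes_integral g A f = (LINT s:A|\<mu>. f s) - (LINT s:A|\<nu>. f s)"
proof -
  let ?\<mu> = "interval_measure V" and ?\<nu> = "interval_measure (\<lambda>t. V t - (g (max 0 t) - g 0))"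
  have 1: "emeasure ?\<mu> {a<..b} = ennreal (V b - V a)" if "a \<le> b" for a b
    by (rule emeasure_interval_measure_Ioc[OF that variation_mono variation_right_continuous])
  have 2: "emeasure ?\<nu> {a<..b} = ennreal (V b - (g (max 0 b) - g 0) - (V a - (g (max 0 a) - g 0)))"
    if "a \<le> b" for a b
    by (rule emeasure_interval_measure_Ioc[OF that variation_minus_mono variation_minus_right_continuous])
  show ?thesis
  proof (rule that[of ?\<mu> ?\<nu>])
    fix a b :: real assume ab: "0 \<le> a" "a \<le> b"
    then show "measure ?\<mu> {a<..b} - measure ?\<nu> {a<..b} = g b - g a"
      using variation_mono[of a b] variation_minus_mono[of a b]
      by (simp add: measure_def 1 2 enn2real_ennreal)
  next
    show "stieltjes_integral g A f = (LINT s:A|?\<mu>. f s) - (LINT s:A|?\<nu>. f s)" for A f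
      by (simp add: stieltjes_integral_def V_def Let_def)
  qed (auto simp: 1 2)
qed

end

text \<open>
  The step functions that take on each cell the value of \<open>z\<close> at its right end converge to \<open>z\<close>
  boundedly, so this is dominated convergence. Allowing an arbitrary measure and a density lets
  the same statement serve the Stieltjes part and the drift part of a path.
\<close>

lemma right_riemann_sums_tendsto:
  fixes z f :: "real \<Rightarrow> real"
  assumes \<mu>: "sets \<mu> = sets borel" and t: "0 < t"
    and z: "continuous_on {0..t} z"
    and f: "set_integrable \<mu> {0<..t} f"
  shows "(\<lambda>n. \<Sum>j<n. z (t * real (Suc j) / real n)
            * (LINT s:{t * real j / real n<..t * real (Suc j) / real n}|\<mu>. f s))
         \<longlonglongrightarrow> (LINT s:{0<..t}|\<mu>. z s * f s)"
proof -
  define r where "r n j = t * real j / real n" for n j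
  define I where "I n j = {r n j<..r n (Suc j)}" for n j
  have [measurable]: "I n j \<in> sets \<mu>" "{0<..t} \<in> sets \<mu>" for n j using \<mu> by (auto simp: I_def)
  define F where "F n s = (\<Sum>j<n. z (r n (Suc j)) * (indicator (I n j) s * f s))" for n s
  obtain C where C: "\<And>s. s \<in> {0..t} \<Longrightarrow> \<bar>z s\<bar> \<le> C"
    using compact_imp_bounded[OF compact_continuous_image[OF z compact_Icc]]
    unfolding bounded_iff by (metis image_eqI real_norm_def)
  have r0: "0 \<le> r n j" for n j using t by (simp add: r_def)
  have r1: "r n j \<le> t" if "j \<le> n" for n j using t that by (cases "n = 0") (auto simp: r_def field_simps)
  have I_sub: "I n j \<subseteq> {0<..t}" if "j < n" for n j
    using r0[of n j] r1[of "Suc j" n] that unfolding I_def by auto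
  have fI: "integrable \<mu> (\<lambda>s. indicator (I n j) s * f s)" if "j < n" for n j
    using set_integrable_subset[OF f _ I_sub[OF that]] unfolding set_integrable_def by simp
  have rep: "F n s = z (r n (nat \<lceil>n * s / t\<rceil>)) * f s \<and> \<bar>r n (nat \<lceil>n * s / t\<rceil>) - s\<bar> \<le> t / n
      \<and> r n (nat \<lceil>n * s / t\<rceil>) \<in> {0..t}"
    if s: "s \<in> {0<..t}" and n: "n > 0" for n s
  proof -
    define j where "j = nat \<lceil>n * s / t\<rceil> - 1"
    have pos: "0 < n * s / t" using s n t by auto
    then have c1: "\<lceil>n * s / t\<rceil> \<ge> 1" by linarith
    have "n * s / t \<le> n" using s n t by (simp add: field_simps)
    then have "\<lceil>n * s / t\<rceil> \<le> int n" by (simp add: ceiling_le_iff)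
    then have jn: "j < n" and Sj: "Suc j = nat \<lceil>n * s / t\<rceil>" using c1 unfolding j_def by linarith+
    have "real j < n * s / t" "n * s / t \<le> real (Suc j)" using c1 Sj by linarith+
    note j_bounds = this
    then have sj: "r n j < s" "s \<le> r n (Suc j)" using n t by (auto simp: r_def field_simps)
    have uniq: "i = j" if i: "s \<in> I n i" for i
    proof -
      have "real i < n * s / t" "n * s / t \<le> real (Suc i)"
        using i t n by (auto simp: I_def r_def field_simps)
      with j_bounds have "real i < real (Suc j)" "real j < real (Suc i)" by linarith+
      then show ?thesis by simp
    qed
    have "F n s = (\<Sum>i<n. if i = j then z (r n (Suc j)) * f s else 0)"
      unfolding F_def
    proof (rule sum.cong[OF refl])
      fix i
      have "s \<in> I n i \<longleftrightarrow> i = j" using uniq[of i] sj by (auto simp: I_def)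
      then show "z (r n (Suc i)) * (indicator (I n i) s * f s) = (if i = j then z (r n (Suc j)) * f s else 0)"
        by (simp add: indicator_def)
    qed
    also have "\<dots> = z (r n (Suc j)) * f s" using jn by simp
    finally have "F n s = z (r n (Suc j)) * f s" .
    moreover have "r n (Suc j) - r n j = t / n" by (simp add: r_def diff_divide_distrib[symmetric] algebra_simps)
    then have "\<bar>r n (Suc j) - s\<bar> \<le> t / n" using sj by linarith
    moreover have "r n (Suc j) \<in> {0..t}" using r0[of n "Suc j"] r1[of "Suc j" n] jn by simp
    ultimately show ?thesis unfolding Sj[symmetric] by blast
  qed
  have F_out: "F n s = 0" if "s \<notin> {0<..t}" for n s
    unfolding F_def
  proof (intro sum.neutral ballI)
    fix j assume "j \<in> {..<n}"
    then have "s \<notin> I n j" using I_sub[of j n] that by auto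
    then show "z (r n (Suc j)) * (indicator (I n j) s * f s) = 0" by simp
  qed
  have zind: "(\<lambda>s. indicator {0<..t} s * z s) \<in> borel_measurable \<mu>"
  proof -
    have "continuous_on {0<..t} z" using z by (rule continuous_on_subset) auto
    then have "(\<lambda>s. indicator {0<..t} s *\<^sub>R z s) \<in> borel_measurable borel"
      by (rule borel_measurable_continuous_on_indicator[rotated]) auto
    then show ?thesis using measurable_cong_sets[OF \<mu> refl] by auto
  qed
  have fm: "(\<lambda>s. indicator {0<..t} s * f s) \<in> borel_measurable \<mu>"
    using f unfolding set_integrable_def by auto
  have "(\<lambda>n. \<integral>s. F n s \<partial>\<mu>) \<longlonglongrightarrow> (\<integral>s. indicator {0<..t} s * (z s * f s) \<partial>\<mu>)"
  proof (rule integral_dominated_convergence[where w = "\<lambda>s. C * \<bar>indicator {0<..t} s * f s\<bar>"])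
    have "(\<lambda>s. (indicator {0<..t} s * z s) * (indicator {0<..t} s * f s)) \<in> borel_measurable \<mu>"
      using zind fm by (rule borel_measurable_times)
    moreover have "(\<lambda>s. (indicator {0<..t} s * z s) * (indicator {0<..t} s * f s))
        = (\<lambda>s. indicator {0<..t} s * (z s * f s) :: real)" by (auto simp: indicator_def)
    ultimately show "(\<lambda>s. indicator {0<..t} s * (z s * f s)) \<in> borel_measurable \<mu>" by simp
    show "F n \<in> borel_measurable \<mu>" for n
      unfolding F_def
      by (intro borel_measurable_sum
          borel_measurable_times[OF borel_measurable_const borel_measurable_integrable[OF fI]]) simp
    show "integrable \<mu> (\<lambda>s. C * \<bar>indicator {0<..t} s * f s\<bar>)"
      using f unfolding set_integrable_def by (intro integrable_mult_right integrable_abs) simp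
    show "AE s in \<mu>. (\<lambda>n. F n s) \<longlonglongrightarrow> indicator {0<..t} s * (z s * f s)"
    proof (rule AE_I2)
      fix s
      show "(\<lambda>n. F n s) \<longlonglongrightarrow> indicator {0<..t} s * (z s * f s)"
      proof (cases "s \<in> {0<..t}")
        case True
        let ?\<rho> = "\<lambda>n. r n (nat \<lceil>n * s / t\<rceil>)"
        have "\<forall>\<^sub>F n in sequentially. \<bar>?\<rho> n - s\<bar> \<le> t / n"
          using eventually_gt_at_top[of 0] by eventually_elim (use rep[OF True] in auto)
        moreover have "(\<lambda>n. t / real n) \<longlonglongrightarrow> 0" by (rule lim_const_over_n)
        ultimately have "(\<lambda>n. ?\<rho> n - s) \<longlonglongrightarrow> 0"
          by (auto intro: Lim_null_comparison)
        then have "?\<rho> \<longlonglongrightarrow> s" by (simp add: LIM_zero_iff)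
        moreover have "\<forall>\<^sub>F n in sequentially. ?\<rho> n \<in> {0..t}"
          using eventually_gt_at_top[of 0] by eventually_elim (use rep[OF True] in auto)
        ultimately have "(\<lambda>n. z (?\<rho> n)) \<longlonglongrightarrow> z s"
          using True by (intro continuous_on_tendsto_compose[OF z, of ?\<rho> s sequentially]) auto
        then have "(\<lambda>n. z (?\<rho> n) * f s) \<longlonglongrightarrow> z s * f s" by (rule tendsto_mult_right)
        moreover have "\<forall>\<^sub>F n in sequentially. z (?\<rho> n) * f s = F n s"
          using eventually_gt_at_top[of 0] by eventually_elim (use rep[OF True] in auto)
        ultimately show ?thesis using True by (auto intro: Lim_transform_eventually)
      qed (simp add: F_out)
    qed
    show "AE s in \<mu>. norm (F n s) \<le> C * \<bar>indicator {0<..t} s * f s\<bar>" for n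
    proof (rule AE_I2)
      fix s
      show "norm (F n s) \<le> C * \<bar>indicator {0<..t} s * f s\<bar>"
      proof (cases "s \<in> {0<..t} \<and> n > 0")
        case True
        then show ?thesis using rep[of s n] C by (auto simp: abs_mult intro!: mult_right_mono)
      next
        case False
        then have "F n s = 0" using F_out[of s n] by (auto simp: F_def)
        moreover have "0 \<le> C" using C[of 0] t by force
        ultimately show ?thesis by simp
      qed
    qed
  qed
  moreover have "(\<integral>s. F n s \<partial>\<mu>) = (\<Sum>j<n. z (r n (Suc j)) * (LINT s:I n j|\<mu>. f s))" for n
    unfolding F_def set_lebesgue_integral_def using fI
    by (subst Bochner_Integration.integral_sum) (auto intro!: sum.cong)
  ultimately show ?thesis by (simp add: set_lebesgue_integral_def r_def I_def)
qed

lemma stieltjes_integral_right_riemann_sums: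
  fixes g z :: "real \<Rightarrow> real"
  assumes fv: "finite_variation g" and cont: "continuous_on {0..} g"
    and t: "0 < t" and z: "continuous_on {0..t} z"
  shows "(\<lambda>n. \<Sum>j<n. z (t * real (Suc j) / real n)
            * (g (t * real (Suc j) / real n) - g (t * real j / real n)))
         \<longlonglongrightarrow> stieltjes_integral g {0<..t} z"
proof -
  obtain \<mu> \<nu> :: "real measure" where *: "sets \<mu> = sets borel" "sets \<nu> = sets borel"
    "\<And>a b. a \<le> b \<Longrightarrow> emeasure \<mu> {a<..b} < \<infinity>" "\<And>a b. a \<le> b \<Longrightarrow> emeasure \<nu> {a<..b} < \<infinity>"
    "\<And>a b. 0 \<le> a \<Longrightarrow> a \<le> b \<Longrightarrow> measure \<mu> {a<..b} - measure \<nu> {a<..b} = g b - g a"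
    "\<And>A f. stieltjes_integral g A f = (LINT s:A|\<mu>. f s) - (LINT s:A|\<nu>. f s)"
    using stieltjes_integral_as_difference[OF fv cont] by metis
  have one: "(\<lambda>n. \<Sum>j<n. z (t * real (Suc j) / real n)
      * measure \<kappa> {t * real j / real n<..t * real (Suc j) / real n})
      \<longlonglongrightarrow> (LINT s:{0<..t}|\<kappa>. z s)"
    if \<kappa>: "sets \<kappa> = sets borel" "\<And>a b. a \<le> b \<Longrightarrow> emeasure \<kappa> {a<..b} < \<infinity>" for \<kappa>
  proof -
    have I: "{a<..b} \<in> sets \<kappa>" for a b :: real using \<kappa> by simp
    have "set_integrable \<kappa> {0<..t} (\<lambda>_. 1::real)"
      unfolding set_integrable_def using I \<kappa>(2)[of 0 t] t by simp
    from right_riemann_sums_tendsto[OF \<kappa>(1) t z this] show ?thesis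
      using I by (simp add: set_lebesgue_integral_def sets.Int_space_eq2)
  qed
  have "(\<lambda>n. (\<Sum>j<n. z (t * real (Suc j) / real n) * measure \<mu> {t * real j / real n<..t * real (Suc j) / real n})
      - (\<Sum>j<n. z (t * real (Suc j) / real n) * measure \<nu> {t * real j / real n<..t * real (Suc j) / real n}))
      \<longlonglongrightarrow> stieltjes_integral g {0<..t} z"
    unfolding *(6) by (intro tendsto_diff one *)
  moreover have "(\<Sum>j<n. z (t * real (Suc j) / real n) * measure \<mu> {t * real j / real n<..t * real (Suc j) / real n})
      - (\<Sum>j<n. z (t * real (Suc j) / real n) * measure \<nu> {t * real j / real n<..t * real (Suc j) / real n})
      = (\<Sum>j<n. z (t * real (Suc j) / real n)
            * (g (t * real (Suc j) / real n) - g (t * real j / real n)))" for n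
  proof -
    have "g (t * real (Suc j) / real n) - g (t * real j / real n)
       = measure \<mu> {t * real j / real n<..t * real (Suc j) / real n}
         - measure \<nu> {t * real j / real n<..t * real (Suc j) / real n}" for j
      by (rule *(5)[symmetric]) (use t in \<open>auto intro!: divide_right_mono\<close>)
    then show ?thesis by (simp add: sum_subtractf[symmetric] right_diff_distrib)
  qed
  ultimately show ?thesis by simp
qed

section \<open>Comparison with a test path\<close>

lemma set_lborel_integral_Ioc_eq_diff:
  fixes f :: "real \<Rightarrow> real"
  assumes f: "continuous_on {0..t} f" and ab: "0 \<le> a" "a \<le> b" "b \<le> t"
  shows "(LINT s:{a<..b}|lborel. f s) = integral {0..b} f - integral {0..a} f"
proof -
  have cont: "continuous_on {a..b} f" using f by (rule continuous_on_subset) (use ab in auto)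
  then have "set_integrable lborel {a..b} f" by (rule borel_integrable_atLeastAtMost')
  then have int: "set_integrable lborel {a<..b} f" by (rule set_integrable_subset) auto
  have "(LINT s:{a<..b}|lborel. f s) = integral {a<..b} f"
    using int by (rule set_borel_integral_eq_integral)
  also have "\<dots> = integral {a..b} f"
  proof (rule integral_subset_negligible)
    show "negligible ({a..b} - {a<..b})" by (rule negligible_subset[of "{a}"]) auto
  qed auto
  also have "integral {0..a} f + integral {a..b} f = integral {0..b} f"
    using ab f by (intro Henstock_Kurzweil_Integration.integral_combine integrable_continuous_interval)
      (auto elim: continuous_on_subset)
  then have "integral {a..b} f = integral {0..b} f - integral {0..a} f" by simp
  finally show ?thesis .
qed

lemma continuous_on_integral_equation:
  fixes g f z :: "real \<Rightarrow> 'a::euclidean_space"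
  assumes g: "continuous_on {0..} g" and f: "continuous_on {0..t} f"
    and z: "\<And>s. s \<in> {0..t} \<Longrightarrow> z s = z0 - g s - integral {0..s} f"
  shows "continuous_on {0..t} z"
proof (rule continuous_on_eq)
  show "continuous_on {0..t} (\<lambda>s. z0 - g s - integral {0..s} f)"
    by (intro continuous_intros continuous_on_subset[OF g] indefinite_integral_continuous_1
        integrable_continuous_interval f) auto
qed (simp add: z)

text \<open>
  The chain rule for \<open>z\<^sup>2\<close>, as an inequality. Sampling at right ends gives
  \<open>z\<^sub>j\<^sub>+\<^sub>1\<^sup>2 - z\<^sub>j\<^sup>2 \<le> 2 z\<^sub>j\<^sub>+\<^sub>1 (z\<^sub>j\<^sub>+\<^sub>1 - z\<^sub>j)\<close>: the squared increments
  have the favourable sign.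
\<close>

lemma square_increment_le:
  fixes g f z :: "real \<Rightarrow> real"
  assumes g: "finite_variation g" "continuous_on {0..} g" and t: "0 < t"
    and f: "continuous_on {0..t} f"
    and z: "\<And>s. s \<in> {0..t} \<Longrightarrow> z s = z0 - g s - integral {0..s} f"
  shows "(z t)\<^sup>2 - (z 0)\<^sup>2
    \<le> - 2 * stieltjes_integral g {0<..t} z - 2 * (LINT s:{0<..t}|lborel. z s * f s)"
proof -
  have zc: "continuous_on {0..t} z" by (rule continuous_on_integral_equation[OF g(2) f z])
  have "set_integrable lborel {0..t} f" using f by (rule borel_integrable_atLeastAtMost')
  then have fi: "set_integrable lborel {0<..t} f" by (rule set_integrable_subset) auto
  let ?r = "\<lambda>n j. t * real j / real n"
  have square: "a\<^sup>2 - b\<^sup>2 \<le> - 2 * (a * d) - 2 * (a * I)" if "a - b = - d - I" for a b d I :: real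
  proof -
    have b: "b = a + (d + I)" using that by simp
    show ?thesis unfolding b using zero_le_power2[of "d + I"] by (simp add: power2_eq_square algebra_simps)
  qed
  have lim: "(\<lambda>n. - 2 * (\<Sum>j<n. z (?r n (Suc j)) * (g (?r n (Suc j)) - g (?r n j)))
       - 2 * (\<Sum>j<n. z (?r n (Suc j)) * (LINT s:{?r n j<..?r n (Suc j)}|lborel. f s)))
     \<longlonglongrightarrow> - 2 * stieltjes_integral g {0<..t} z - 2 * (LINT s:{0<..t}|lborel. z s * f s)"
    by (intro tendsto_intros stieltjes_integral_right_riemann_sums[OF g t zc]
        right_riemann_sums_tendsto[OF _ t zc fi]) simp
  have "(z t)\<^sup>2 - (z 0)\<^sup>2 \<le> - 2 * (\<Sum>j<n. z (?r n (Suc j)) * (g (?r n (Suc j)) - g (?r n j)))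
       - 2 * (\<Sum>j<n. z (?r n (Suc j)) * (LINT s:{?r n j<..?r n (Suc j)}|lborel. f s))"
    if n: "0 < n" for n
  proof -
    have "(z t)\<^sup>2 - (z 0)\<^sup>2 = (\<Sum>j<n. (z (?r n (Suc j)))\<^sup>2 - (z (?r n j))\<^sup>2)"
      using n by (subst sum_lessThan_telescope) simp
    also have "\<dots> \<le> (\<Sum>j<n. - 2 * (z (?r n (Suc j)) * (g (?r n (Suc j)) - g (?r n j)))
       - 2 * (z (?r n (Suc j)) * (LINT s:{?r n j<..?r n (Suc j)}|lborel. f s)))"
    proof (rule sum_mono)
      fix j assume "j \<in> {..<n}"
      then have "real (Suc j) / real n \<le> 1" by simp
      then have "t * (real (Suc j) / real n) \<le> t * 1" using t by (intro mult_left_mono) auto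
      then have "?r n (Suc j) \<le> t" by simp
      moreover have "0 \<le> ?r n j" using t by simp
      moreover have "?r n j \<le> ?r n (Suc j)"
        by (intro divide_right_mono mult_left_mono) (use t in auto)
      ultimately have "z (?r n (Suc j)) - z (?r n j)
          = - (g (?r n (Suc j)) - g (?r n j)) - (LINT s:{?r n j<..?r n (Suc j)}|lborel. f s)"
        using set_lborel_integral_Ioc_eq_diff[OF f, of "?r n j" "?r n (Suc j)"]
          z[of "?r n (Suc j)"] z[of "?r n j"] by (simp del: of_nat_Suc)
      then show "(z (?r n (Suc j)))\<^sup>2 - (z (?r n j))\<^sup>2
          \<le> - 2 * (z (?r n (Suc j)) * (g (?r n (Suc j)) - g (?r n j)))
            - 2 * (z (?r n (Suc j)) * (LINT s:{?r n j<..?r n (Suc j)}|lborel. f s))"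
        by (rule square)
    qed
    also have "\<dots> = - 2 * (\<Sum>j<n. z (?r n (Suc j)) * (g (?r n (Suc j)) - g (?r n j)))
       - 2 * (\<Sum>j<n. z (?r n (Suc j)) * (LINT s:{?r n j<..?r n (Suc j)}|lborel. f s))"
      by (simp add: sum_subtractf sum_distrib_left sum_negf)
    finally show ?thesis .
  qed
  then show ?thesis by (intro LIMSEQ_le_const[OF lim]) (auto intro!: exI[of _ 1])
qed

text \<open>
  Sum over coordinates and use the pairing inequality on \<open>{0<..t}\<close> to replace \<open>\<langle>Z, dK\<rangle>\<close> by
  \<open>Z \<bullet> b ds\<close>.
\<close>

lemma norm_square_increment_le:
  fixes K f Z b :: "real \<Rightarrow> real ^ 'n::finite"
  assumes K: "finite_variation K" "continuous_on {0..} K" and t: "0 < t"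
    and f: "continuous_on {0..t} f" and b: "continuous_on {0..t} b"
    and Z: "\<And>s. s \<in> {0..t} \<Longrightarrow> Z s = z0 - K s - integral {0..s} f"
    and nonneg: "nonneg_on_half_line (pairing_measure Z K b)"
  shows "(norm (Z t))\<^sup>2 \<le> (norm (Z 0))\<^sup>2 - 2 * (LINT s:{0<..t}|lborel. Z s \<bullet> (f s + b s))"
proof -
  have fint: "f integrable_on {0..s}" if "s \<le> t" for s
    using f that by (intro integrable_continuous_interval continuous_on_subset[OF f]) auto
  have Zc: "continuous_on {0..t} Z" by (rule continuous_on_integral_equation[OF K(2) f Z])
  have fi: "continuous_on {0..t} (\<lambda>s. f s $ i)" for i using f by (intro continuous_intros)
  have int: "set_integrable lborel {0<..t} h" if "continuous_on {0..t} h" for h :: "real \<Rightarrow> real"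
    using borel_integrable_atLeastAtMost'[OF that] by (rule set_integrable_subset) auto
  have comp: "(Z t $ i)\<^sup>2 - (Z 0 $ i)\<^sup>2
    \<le> - 2 * stieltjes_integral (\<lambda>s. K s $ i) {0<..t} (\<lambda>s. Z s $ i) - 2 * (LINT s:{0<..t}|lborel. Z s $ i * f s $ i)" for i
  proof (rule square_increment_le[OF finite_variation_component[OF K(1)] _ t fi])
    show "continuous_on {0..} (\<lambda>s. K s $ i)" using K by (intro continuous_intros)
    show "Z s $ i = z0 $ i - K s $ i - integral {0..s} (\<lambda>s. f s $ i)" if "s \<in> {0..t}" for s
      using Z[OF that] fint[of s] that by (simp add: integral_component_eq_cart)
  qed
  have "0 \<le> pairing_measure Z K b {0<..t}"
  proof -
    have "{0<..t} \<in> sets borel" "{0<..t} \<subseteq> {0..}" by auto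
    moreover have "bounded {0<..t}" by (rule bounded_subset[OF bounded_closed_interval[of 0 t]]) auto
    ultimately show ?thesis using nonneg unfolding nonneg_on_half_line_def by blast
  qed
  then have pair: "(LINT s:{0<..t}|lborel. Z s \<bullet> b s)
      \<le> (\<Sum>i\<in>UNIV. stieltjes_integral (\<lambda>s. K s $ i) {0<..t} (\<lambda>s. Z s $ i))"
    by (simp add: pairing_measure_def)
  have "(LINT s:{0<..t}|lborel. Z s \<bullet> f s) = (LINT s:{0<..t}|lborel. (\<Sum>i\<in>UNIV. Z s $ i * f s $ i))"
    by (simp add: inner_vec_def)
  also have "\<dots> = (\<Sum>i\<in>UNIV. LINT s:{0<..t}|lborel. Z s $ i * f s $ i)"
  proof -
    have "integrable lborel (\<lambda>s. indicator {0<..t} s * (Z s $ i * f s $ i))" for i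
    proof -
      have "continuous_on {0..t} (\<lambda>s. Z s $ i * f s $ i)" by (intro continuous_intros Zc f)
      from int[OF this] show ?thesis by (simp add: set_integrable_def)
    qed
    then show ?thesis
      unfolding set_lebesgue_integral_def real_scaleR_def sum_distrib_left
      by (rule Bochner_Integration.integral_sum)
  qed
  finally have f_sum: "(LINT s:{0<..t}|lborel. Z s \<bullet> f s) = (\<Sum>i\<in>UNIV. LINT s:{0<..t}|lborel. Z s $ i * f s $ i)" .
  have "(norm (Z t))\<^sup>2 - (norm (Z 0))\<^sup>2 = (\<Sum>i\<in>UNIV. (Z t $ i)\<^sup>2 - (Z 0 $ i)\<^sup>2)"
    unfolding power2_norm_eq_inner inner_vec_def by (simp add: sum_subtractf power2_eq_square)
  also have "\<dots> \<le> (\<Sum>i\<in>UNIV. - 2 * stieltjes_integral (\<lambda>s. K s $ i) {0<..t} (\<lambda>s. Z s $ i) - 2 * (LINT s:{0<..t}|lborel. Z s $ i * f s $ i))"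
    by (intro sum_mono comp)
  also have "\<dots> = - 2 * (\<Sum>i\<in>UNIV. stieltjes_integral (\<lambda>s. K s $ i) {0<..t} (\<lambda>s. Z s $ i)) - 2 * (LINT s:{0<..t}|lborel. Z s \<bullet> f s)"
    by (simp add: f_sum sum_subtractf sum_distrib_left sum_negf)
  also have "\<dots> \<le> - 2 * ((LINT s:{0<..t}|lborel. Z s \<bullet> f s) + (LINT s:{0<..t}|lborel. Z s \<bullet> b s))"
    using pair by simp
  also have "(LINT s:{0<..t}|lborel. Z s \<bullet> f s) + (LINT s:{0<..t}|lborel. Z s \<bullet> b s) = (LINT s:{0<..t}|lborel. Z s \<bullet> (f s + b s))"
    by (subst set_integral_add(2)[symmetric]) (auto intro!: int continuous_intros Zc f b simp: inner_add_right)
  finally show ?thesis by simp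
qed

text \<open>
  Evaluate the previous inequality at a time where \<open>|Z|\<close> is maximal, with value \<open>m\<close>: it reads
  \<open>m\<^sup>2 \<le> |Z 0|\<^sup>2 + 2 T e m\<close>, and \<open>|Z 0| \<le> m\<close>.
\<close>

lemma dissipative_comparison:
  fixes K f Z b :: "real \<Rightarrow> real ^ 'n::finite"
  assumes K: "finite_variation K" "continuous_on {0..} K" and T: "0 < T" and e: "0 \<le> e"
    and f: "continuous_on {0..T} f" and b: "continuous_on {0..T} b"
    and Z: "\<And>s. s \<in> {0..T} \<Longrightarrow> Z s = z0 - K s - integral {0..s} f"
    and nonneg: "nonneg_on_half_line (pairing_measure Z K b)"
    and diss: "\<And>s. s \<in> {0..T} \<Longrightarrow> - e * norm (Z s) \<le> Z s \<bullet> (f s + b s)"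
    and t: "t \<in> {0..T}"
  shows "norm (Z t) \<le> norm (Z 0) + 2 * T * e"
proof -
  have Zc: "continuous_on {0..T} Z" by (rule continuous_on_integral_equation[OF K(2) f Z])
  then have "continuous_on {0..T} (\<lambda>s. norm (Z s))" by (intro continuous_intros)
  then obtain s where s: "s \<in> {0..T}" and max: "\<And>r. r \<in> {0..T} \<Longrightarrow> norm (Z r) \<le> norm (Z s)"
    using continuous_attains_sup[OF compact_Icc, of 0 T "\<lambda>s. norm (Z s)"] T by auto
  define m where "m = norm (Z s)"
  have "m \<le> norm (Z 0) + 2 * T * e"
  proof (cases "s = 0")
    case True
    then show ?thesis using T e by (simp add: m_def)
  next
    case False
    then have s0: "0 < s" using s by simp
    have sub: "continuous_on {0..s} h" if "continuous_on {0..T} h" for h :: "real \<Rightarrow> real ^ 'n"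
      using that by (rule continuous_on_subset) (use s in auto)
    have "m\<^sup>2 \<le> (norm (Z 0))\<^sup>2 - 2 * (LINT r:{0<..s}|lborel. Z r \<bullet> (f r + b r))"
      unfolding m_def
      by (rule norm_square_increment_le[OF K s0 sub[OF f] sub[OF b] _ nonneg]) (use Z s in auto)
    moreover have "(LINT r:{0<..s}|lborel. - e * m) \<le> (LINT r:{0<..s}|lborel. Z r \<bullet> (f r + b r))"
    proof (rule set_integral_mono)
      show "set_integrable lborel {0<..s} (\<lambda>r. - e * m)"
        unfolding set_integrable_def using s0 by simp
      have "continuous_on {0..s} (\<lambda>r. Z r \<bullet> (f r + b r))"
        by (intro continuous_intros sub Zc f b)
      then have "set_integrable lborel {0..s} (\<lambda>r. Z r \<bullet> (f r + b r))" by (rule borel_integrable_atLeastAtMost')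
      then show "set_integrable lborel {0<..s} (\<lambda>r. Z r \<bullet> (f r + b r))" by (rule set_integrable_subset) auto
      fix r assume "r \<in> {0<..s}"
      then have r: "r \<in> {0..T}" using s by auto
      have "- e * m \<le> - e * norm (Z r)" using max[OF r] e by (simp add: m_def mult_left_mono)
      also have "\<dots> \<le> Z r \<bullet> (f r + b r)" by (rule diss[OF r])
      finally show "- e * m \<le> Z r \<bullet> (f r + b r)" .
    qed
    moreover have "(LINT r:{0<..s}|lborel. - e * m) = s * (- e * m)"
      unfolding set_lebesgue_integral_def using s0 by simp
    ultimately have "m\<^sup>2 \<le> (norm (Z 0))\<^sup>2 + 2 * s * e * m" by (simp add: algebra_simps)
    also have "\<dots> \<le> (norm (Z 0))\<^sup>2 + 2 * T * e * m"
      using s e by (intro add_left_mono mult_right_mono) (auto simp: m_def)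
    also have "\<dots> \<le> m * norm (Z 0) + 2 * T * e * m"
      using max[of 0] T by (simp add: m_def power2_eq_square mult_right_mono)
    finally have "m * m \<le> m * (norm (Z 0) + 2 * T * e)" by (simp add: power2_eq_square algebra_simps)
    then show ?thesis using T e by (cases "m = 0") (auto simp: m_def)
  qed
  then show ?thesis using max[OF t] by (simp add: m_def)
qed

section \<open>Brownian motion follows every continuous path with positive probability\<close>

text \<open>
  Fubini for product densities in coordinates, used to read off the law of a box from the
  density of a Brownian increment.
\<close>

lemma nn_integral_lborel_vec_prod:
  fixes f :: "'n::finite \<Rightarrow> real \<Rightarrow> ennreal"
  assumes "\<And>i. f i \<in> borel_measurable borel"
  shows "(\<integral>\<^sup>+ z. (\<Prod>i\<in>UNIV. f i (z $ i)) \<partial>(lborel :: (real ^ 'n) measure)) = (\<Prod>i\<in>UNIV. \<integral>\<^sup>+ u. f i u \<partial>lborel)"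
proof -
  have B: "(Basis :: (real ^ 'n) set) = range (\<lambda>i. axis i 1)" by (auto simp: Basis_vec_def)
  have inj: "inj (\<lambda>i::'n. axis i (1::real))" by (auto simp: inj_on_def axis_eq_axis)
  define g where "g b = f (inv (\<lambda>i::'n. axis i (1::real)) b)" for b
  have g: "g (axis i 1) = f i" for i using inv_f_f[OF inj] by (simp add: g_def)
  have "(\<integral>\<^sup>+ z. (\<Prod>b\<in>Basis. g b (z \<bullet> b)) \<partial>(lborel :: (real ^ 'n) measure)) = (\<Prod>b\<in>Basis. \<integral>\<^sup>+ u. g b u \<partial>lborel)"
    by (rule nn_integral_lborel_prod) (use assms in \<open>auto simp: g_def\<close>)
  then show ?thesis by (simp add: B prod.reindex[OF inj] g inner_axis)
qed

text \<open>
  Chebyshev's inequality.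
\<close>

lemma normal_tail_le:
  assumes "0 < \<sigma>" "0 < l"
  shows "measure (density lborel (normal_density 0 \<sigma>)) {u. l \<le> \<bar>u\<bar>} \<le> \<sigma>\<^sup>2 / l\<^sup>2"
proof -
  let ?N = "density lborel (normal_density 0 \<sigma>)"
  interpret N: prob_space ?N by (rule prob_space_normal_density) (use assms in simp)
  have sq: "has_bochner_integral lborel (\<lambda>x. normal_density 0 \<sigma> x * x\<^sup>2) (\<sigma>\<^sup>2)"
    using normal_moment_even[of \<sigma> 0 1] assms by (simp add: fact_numeral)
  then have int: "integrable ?N (\<lambda>x. x\<^sup>2)" and val: "(\<integral>x. x\<^sup>2 \<partial>?N) = \<sigma>\<^sup>2"
    by (auto simp: integrable_real_density integral_real_density has_bochner_integral_iff)
  have eq: "{u. l \<le> \<bar>u\<bar>} = {u \<in> space ?N. l\<^sup>2 \<le> u\<^sup>2}"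
    using assms by (auto simp: abs_le_square_iff[symmetric])
  have "N.prob {u \<in> space ?N. l\<^sup>2 \<le> u\<^sup>2} \<le> (\<integral>x. x\<^sup>2 \<partial>?N) / l\<^sup>2"
    by (rule integral_Markov_inequality_measure[OF int]) (use assms in auto)
  then show ?thesis by (simp add: eq val)
qed

definition normal_exceedance_bound :: real where "normal_exceedance_bound = exp (- 2) / sqrt (2 * pi)"

lemma normal_exceedance_bound_pos: "0 < normal_exceedance_bound" by (simp add: normal_exceedance_bound_def)

text \<open>
  On \<open>[\<sigma>, 2 \<sigma>]\<close> the density is at least \<open>exp (- 2) / (sqrt (2 * pi) * \<sigma>)\<close>, and the interval has length
  \<open>\<sigma>\<close>: the bound does not depend on \<open>\<sigma>\<close>.
\<close>

lemma normal_beyond_sd_ge: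
  assumes \<sigma>: "0 < \<sigma>"
  shows "normal_exceedance_bound \<le> measure (density lborel (normal_density 0 \<sigma>)) {\<sigma>..}"
    and "normal_exceedance_bound \<le> measure (density lborel (normal_density 0 \<sigma>)) {..-\<sigma>}"
proof -
  let ?N = "density lborel (normal_density 0 \<sigma>)"
  interpret N: prob_space ?N by (rule prob_space_normal_density) (use assms in simp)
  have dens: "normal_exceedance_bound / \<sigma> \<le> normal_density 0 \<sigma> u" if "\<bar>u\<bar> \<le> 2 * \<sigma>" for u
  proof -
    have "u\<^sup>2 \<le> (2 * \<sigma>)\<^sup>2" by (rule abs_le_square_iff[THEN iffD1]) (use that \<sigma> in simp)
    then have "u\<^sup>2 / (2 * \<sigma>\<^sup>2) \<le> 2" using \<sigma> by (simp add: field_simps power2_eq_square)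
    then have "exp (- 2) \<le> exp (- (u\<^sup>2) / (2 * \<sigma>\<^sup>2))" by simp
    then have "exp (- 2) / (sqrt (2 * pi) * \<sigma>) \<le> exp (- (u\<^sup>2) / (2 * \<sigma>\<^sup>2)) / (sqrt (2 * pi) * \<sigma>)"
      using \<sigma> by (intro divide_right_mono) auto
    then show ?thesis using \<sigma> by (simp add: normal_density_def normal_exceedance_bound_def real_sqrt_mult)
  qed
  have gen: "normal_exceedance_bound \<le> measure ?N {a..a + \<sigma>}" if a: "\<And>u. u \<in> {a..a+\<sigma>} \<Longrightarrow> \<bar>u\<bar> \<le> 2 * \<sigma>" for a
  proof -
    have "ennreal normal_exceedance_bound = (\<integral>\<^sup>+u. ennreal (normal_exceedance_bound / \<sigma>) * indicator {a..a+\<sigma>} u \<partial>lborel)"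
      using \<sigma> normal_exceedance_bound_pos by (simp add: nn_integral_cmult_indicator ennreal_mult[symmetric])
    also have "\<dots> \<le> (\<integral>\<^sup>+u. ennreal (normal_density 0 \<sigma> u) * indicator {a..a+\<sigma>} u \<partial>lborel)"
      using dens a by (intro nn_integral_mono) (auto simp: indicator_def intro!: ennreal_leI)
    also have "\<dots> = emeasure ?N {a..a+\<sigma>}" by (simp add: emeasure_density)
    finally show ?thesis by (simp add: N.emeasure_eq_measure)
  qed
  have "measure ?N {\<sigma>..\<sigma>+\<sigma>} \<le> measure ?N {\<sigma>..}" by (rule N.finite_measure_mono) auto
  then show "normal_exceedance_bound \<le> measure ?N {\<sigma>..}" using gen[of \<sigma>] \<sigma> by force
  have "measure ?N {-2*\<sigma>..-2*\<sigma>+\<sigma>} \<le> measure ?N {..-\<sigma>}" by (rule N.finite_measure_mono) auto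
  then show "normal_exceedance_bound \<le> measure ?N {..-\<sigma>}" using gen[of "-2*\<sigma>"] \<sigma> by force
qed

lemma borel_measurable_vec_nth: "(\<lambda>z :: real ^ 'n::finite. z $ i) \<in> borel_measurable borel"
  by (intro borel_measurable_continuous_onI continuous_intros)

locale brownian = prob_space M for M :: "'w measure" +
  fixes F :: "real \<Rightarrow> 'w measure" and B :: "real \<Rightarrow> 'w \<Rightarrow> real ^ 'n::finite"
  assumes filtration: "usual_filtration M F" and brownian: "brownian_motion M F B"
begin

abbreviation inc :: "real \<Rightarrow> real \<Rightarrow> 'n \<Rightarrow> 'w \<Rightarrow> real" where
  "inc s t i \<omega> \<equiv> B t \<omega> $ i - B s \<omega> $ i"

lemma subalgebra_F: "0 \<le> t \<Longrightarrow> subalgebra M (F t)"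
  using filtration unfolding usual_filtration_def by (elim conjE) (erule allE, erule mp)

lemma space_F: "0 \<le> t \<Longrightarrow> space (F t) = space M"
  using subalgebra_F by (simp add: subalgebra_def)

lemma sets_F: "0 \<le> t \<Longrightarrow> sets (F t) \<subseteq> sets M"
  using subalgebra_F by (simp add: subalgebra_def)

lemma F_mono:
  assumes "0 \<le> s" "s \<le> t"
  shows "sets (F s) \<subseteq> sets (F t)"
proof -
  have "\<forall>s t. 0 \<le> s \<and> s \<le> t \<longrightarrow> sets (F s) \<subseteq> sets (F t)"
    using filtration unfolding usual_filtration_def by (elim conjE)
  then show ?thesis using assms by (elim allE[of _ s] allE[of _ t]) simp
qed

lemma B_measurable_F:
  assumes "0 \<le> s" "s \<le> t"
  shows "B s \<in> borel_measurable (F t)"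
proof (rule measurable_from_subalg)
  show "subalgebra (F t) (F s)" using assms by (simp add: subalgebra_def space_F F_mono)
  show "B s \<in> borel_measurable (F s)"
    using brownian assms by (simp add: brownian_motion_def adapted_process_def)
qed

lemma B_component_measurable_F:
  assumes "0 \<le> s" "s \<le> t"
  shows "(\<lambda>\<omega>. B s \<omega> $ i) \<in> borel_measurable (F t)"
  by (rule measurable_compose[OF B_measurable_F[OF assms] borel_measurable_vec_nth])

lemma B_measurable [measurable]: "0 \<le> s \<Longrightarrow> B s \<in> borel_measurable M"
  by (rule measurable_from_subalg[OF subalgebra_F B_measurable_F]) auto

lemma B_component_measurable [measurable]:
  assumes "0 \<le> s"
  shows "(\<lambda>\<omega>. B s \<omega> $ i) \<in> borel_measurable M"
  by (rule measurable_compose[OF B_measurable[OF assms] borel_measurable_vec_nth])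

lemma independent_increment:
  assumes "0 \<le> s" "s < t" "A \<in> sets (F s)" "C \<in> sets borel"
  shows "prob (A \<inter> {\<omega> \<in> space M. B t \<omega> - B s \<omega> \<in> C}) = prob A * prob {\<omega> \<in> space M. B t \<omega> - B s \<omega> \<in> C}"
proof -
  have "indep_set (sets (F s)) (sets (vimage_algebra (space M) (\<lambda>\<omega>. B t \<omega> - B s \<omega>) borel))"
    using brownian assms by (auto simp: brownian_motion_def)
  moreover have "{\<omega> \<in> space M. B t \<omega> - B s \<omega> \<in> C} \<in> sets (vimage_algebra (space M) (\<lambda>\<omega>. B t \<omega> - B s \<omega>) borel)"
    using in_vimage_algebra[OF assms(4), of "\<lambda>\<omega>. B t \<omega> - B s \<omega>" "space M"]
    by (simp add: vimage_def Int_def conj_commute)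
  ultimately show ?thesis using assms(3) by (intro indep_setD)
qed

lemma prob_increment_in_box:
  assumes st: "0 \<le> s" "s < t" and C: "\<And>i. C i \<in> sets borel"
  shows "prob {\<omega> \<in> space M. \<forall>i. inc s t i \<omega> \<in> C i}
    = (\<Prod>i\<in>UNIV. measure (density lborel (normal_density 0 (sqrt (t - s)))) (C i))"
proof -
  let ?\<sigma> = "sqrt (t - s)"
  let ?N = "density lborel (normal_density 0 ?\<sigma>)"
  interpret N: prob_space ?N by (rule prob_space_normal_density) (use st in simp)
  let ?Z = "\<lambda>\<omega>. B t \<omega> - B s \<omega>"
  let ?f = "\<lambda>z::real^'n. ennreal (\<Prod>i\<in>UNIV. normal_density 0 ?\<sigma> (z $ i))"
  have d: "distributed M lborel ?Z ?f" using brownian st by (auto simp: brownian_motion_def)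
  have box: "{z :: real^'n. \<forall>i. z $ i \<in> C i} \<in> sets borel"
  proof -
    have "{z :: real^'n. \<forall>i. z $ i \<in> C i} = (\<Inter>i. (\<lambda>z. z $ i) -` C i \<inter> space borel)" by auto
    also have "\<dots> \<in> sets borel"
      using measurable_sets[OF borel_measurable_vec_nth C] by (intro sets.countable_INT'') auto
    finally show ?thesis .
  qed
  have "ennreal (prob {\<omega> \<in> space M. \<forall>i. inc s t i \<omega> \<in> C i}) = emeasure M (?Z -` {z. \<forall>i. z $ i \<in> C i} \<inter> space M)"
    by (simp add: emeasure_eq_measure vimage_def Int_def conj_commute)
  also have "\<dots> = (\<integral>\<^sup>+z. ?f z * indicator {z. \<forall>i. z $ i \<in> C i} z \<partial>lborel)"
    by (rule distributed_emeasure[OF d]) (use box in simp)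
  also have "\<dots> = (\<integral>\<^sup>+z. (\<Prod>i\<in>UNIV. ennreal (normal_density 0 ?\<sigma> (z $ i)) * indicator (C i) (z $ i)) \<partial>lborel)"
  proof (rule nn_integral_cong)
    fix z :: "real^'n"
    show "?f z * indicator {z. \<forall>i. z $ i \<in> C i} z
      = (\<Prod>i\<in>UNIV. ennreal (normal_density 0 ?\<sigma> (z $ i)) * indicator (C i) (z $ i))"
    proof (cases "\<forall>i. z $ i \<in> C i")
      case True
      then show ?thesis by (simp add: prod_ennreal)
    next
      case False
      then obtain i where "z $ i \<notin> C i" by blast
      then have "(\<Prod>i\<in>UNIV. ennreal (normal_density 0 ?\<sigma> (z $ i)) * indicator (C i) (z $ i)) = 0"
        by (intro prod_zero) (auto intro!: exI[of _ i])
      then show ?thesis using False by simp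
    qed
  qed
  also have "\<dots> = (\<Prod>i\<in>UNIV. \<integral>\<^sup>+u. ennreal (normal_density 0 ?\<sigma> u) * indicator (C i) u \<partial>lborel)"
    using C by (intro nn_integral_lborel_vec_prod) auto
  also have "\<dots> = (\<Prod>i\<in>UNIV. ennreal (measure ?N (C i)))"
    using C by (intro prod.cong refl) (simp add: N.emeasure_eq_measure[symmetric] emeasure_density)
  also have "\<dots> = ennreal (\<Prod>i\<in>UNIV. measure ?N (C i))" by (simp add: prod_ennreal)
  finally show ?thesis by (simp add: prod_nonneg)
qed

lemma increment_tail:
  assumes st: "0 \<le> s" "s < t" and l: "0 < l"
  shows "prob {\<omega> \<in> space M. l \<le> \<bar>inc s t i \<omega>\<bar>} \<le> (t - s) / l\<^sup>2"
proof -
  let ?N = "density lborel (normal_density 0 (sqrt (t - s)))"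
  interpret N: prob_space ?N by (rule prob_space_normal_density) (use st in simp)
  define C where "C j = (if j = i then {u. l \<le> \<bar>u\<bar>} else UNIV)" for j
  have "{u::real. l \<le> \<bar>u\<bar>} \<in> sets borel" by measurable
  then have C: "C j \<in> sets borel" for j by (simp add: C_def)
  have "{\<omega> \<in> space M. l \<le> \<bar>inc s t i \<omega>\<bar>} = {\<omega> \<in> space M. \<forall>j. inc s t j \<omega> \<in> C j}"
    by (auto simp: C_def split: if_splits)
  also have "prob \<dots> = (\<Prod>j\<in>UNIV. measure ?N (C j))" by (rule prob_increment_in_box[OF st C])
  also have "\<dots> = (\<Prod>j\<in>UNIV. if j = i then measure ?N {u. l \<le> \<bar>u\<bar>} else 1)"
    using N.prob_space by (intro prod.cong) (auto simp: C_def)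
  also have "\<dots> \<le> (t - s) / l\<^sup>2" using normal_tail_le[of "sqrt (t - s)" l] st l by simp
  finally show ?thesis .
qed

lemma increment_orthant:
  assumes st: "0 \<le> s" "s < t"
  shows "normal_exceedance_bound ^ CARD('n) \<le> prob {\<omega> \<in> space M. \<forall>i. if \<tau> i then inc s t i \<omega> \<le> - sqrt (t - s) else sqrt (t - s) \<le> inc s t i \<omega>}"
proof -
  let ?N = "density lborel (normal_density 0 (sqrt (t - s)))"
  define C where "C j = (if \<tau> j then {..- sqrt (t - s)} else {sqrt (t - s)..})" for j
  have C: "C j \<in> sets borel" for j by (simp add: C_def)
  have "normal_exceedance_bound ^ CARD('n) = (\<Prod>i\<in>(UNIV::'n set). normal_exceedance_bound)" by simp
  also have "\<dots> \<le> (\<Prod>i\<in>UNIV. measure ?N (C i))"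
    using normal_beyond_sd_ge[of "sqrt (t - s)"] st normal_exceedance_bound_pos
    by (intro prod_mono) (auto simp: C_def less_imp_le)
  also have "\<dots> = prob {\<omega> \<in> space M. \<forall>j. inc s t j \<omega> \<in> C j}"
    by (rule prob_increment_in_box[OF st C, symmetric])
  also have "{\<omega> \<in> space M. \<forall>j. inc s t j \<omega> \<in> C j} = {\<omega> \<in> space M. \<forall>i. if \<tau> i then inc s t i \<omega> \<le> - sqrt (t - s) else sqrt (t - s) \<le> inc s t i \<omega>}"
    by (auto simp: C_def)
  finally show ?thesis .
qed

text \<open>
  Ottaviani's inequality, relative to an event \<open>A\<close> of the past. Decompose according to the first
  \<open>r \<in> D\<close> at which the increment reaches \<open>2 l\<close>. This event belongs to \<open>F r\<close>, and the later increment
  from \<open>r\<close> to \<open>t\<close> is independent of it and below \<open>l\<close> with probability at least \<open>1/2\<close>, in which case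
  the increment from \<open>s\<close> to \<open>t\<close> is still at least \<open>l\<close>. The bound is uniform in \<open>D\<close>.
\<close>

lemma ottaviani:
  assumes s: "0 \<le> s" and D: "finite D" "D \<subseteq> {s..t}" and A: "A \<in> sets (F s)"
    and l: "0 < l" and small: "(t - s) / l\<^sup>2 \<le> 1 / 2" and st: "s < t"
  shows "prob {\<omega> \<in> A. \<exists>r\<in>D. 2 * l \<le> \<bar>inc s r i \<omega>\<bar>} \<le> 2 * (t - s) / l\<^sup>2 * prob A"
proof -
  define T where "T r = {\<omega> \<in> A. 2 * l \<le> \<bar>inc s r i \<omega>\<bar> \<and> (\<forall>q\<in>D. q < r \<longrightarrow> \<bar>inc s q i \<omega>\<bar> < 2 * l)}" for r
  define G where "G r = {\<omega> \<in> space M. \<bar>inc r t i \<omega>\<bar> < l}" for r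
  have A_sub: "A \<subseteq> space M" using sets.sets_into_space[OF A] space_F s by simp
  have T_F: "T r \<in> sets (F r)" if r: "r \<in> D" for r
  proof -
    have sr: "s \<le> r" "0 \<le> r" using r D s by auto
    have AF: "A \<in> sets (F r)" using A F_mono[OF s sr(1)] by blast
    have m: "(\<lambda>\<omega>. inc s q i \<omega>) \<in> borel_measurable (F r)" if "s \<le> q" "q \<le> r" for q
      using that s sr by (intro borel_measurable_diff B_component_measurable_F) auto
    have "T r = {\<omega> \<in> space (F r). \<omega> \<in> A \<and> 2 * l \<le> \<bar>inc s r i \<omega>\<bar> \<and> (\<forall>q\<in>{q\<in>D. q < r}. \<bar>inc s q i \<omega>\<bar> < 2 * l)}"
      using A_sub space_F sr by (auto simp: T_def)
    also have "\<dots> \<in> sets (F r)"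
    proof (intro sets.sets_Collect_conj sets.sets_Collect_finite_All)
      show "{\<omega> \<in> space (F r). \<omega> \<in> A} \<in> sets (F r)"
        using AF sets.sets_into_space[OF AF] by (simp add: Collect_conj_eq Int_absorb1 flip: Int_def)
      show "{\<omega> \<in> space (F r). 2 * l \<le> \<bar>inc s r i \<omega>\<bar>} \<in> sets (F r)"
        using m[of r] sr by measurable
      show "{\<omega> \<in> space (F r). \<bar>inc s q i \<omega>\<bar> < 2 * l} \<in> sets (F r)" if "q \<in> {q\<in>D. q < r}" for q
      proof -
        have "s \<le> q" "q \<le> r" using that D by auto
        note [measurable] = m[OF this]
        show ?thesis by measurable
      qed
    qed (use D in auto)
    finally show ?thesis .
  qed
  have T_M: "T r \<in> events" if "r \<in> D" for r using T_F[OF that] sets_F[of r] that D s by fastforce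
  have G_M: "G r \<in> events" if "r \<in> D" for r
  proof -
    have [simp]: "0 \<le> r" "0 \<le> t" using that D s st by auto
    show ?thesis unfolding G_def by measurable
  qed
  have half: "prob (T r) \<le> 2 * prob (T r \<inter> G r)" if r: "r \<in> D" for r
  proof (cases "r = t")
    case True
    then have "T r \<inter> G r = T r" using A_sub l by (auto simp: T_def G_def)
    then show ?thesis by simp
  next
    case False
    then have rt: "0 \<le> r" "r < t" "s \<le> r" using r D s by auto
    have G_eq: "G r = {\<omega> \<in> space M. B t \<omega> - B r \<omega> \<in> {z. \<bar>z $ i\<bar> < l}}" by (auto simp: G_def)
    have "{z :: real^'n. \<bar>z $ i\<bar> < l} \<in> sets borel"
      by (intro borel_open open_Collect_less continuous_intros)
    then have "prob (T r \<inter> G r) = prob (T r) * prob (G r)"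
      unfolding G_eq by (rule independent_increment[OF rt(1,2) T_F[OF r]])
    moreover have "prob (G r) \<ge> 1 / 2"
    proof -
      have "{\<omega> \<in> space M. l \<le> \<bar>inc r t i \<omega>\<bar>} = space M - G r" by (auto simp: G_def)
      then have "1 - prob (G r) \<le> (t - r) / l\<^sup>2"
        using increment_tail[OF rt(1,2) l, of i] prob_compl[OF G_M[OF r]] by simp
      also have "\<dots> \<le> (t - s) / l\<^sup>2" using rt by (intro divide_right_mono) auto
      finally show ?thesis using small by linarith
    qed
    then have "prob (T r) * (1 / 2) \<le> prob (T r) * prob (G r)" by (intro mult_left_mono) auto
    ultimately show ?thesis by simp
  qed
  have disj: "disjoint_family_on (\<lambda>r. T r \<inter> G r) D"
    unfolding disjoint_family_on_def T_def by (auto simp: not_less) (metis linorder_neqE_linordered_idom not_less)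
  define E where "E = {\<omega> \<in> space M. B t \<omega> - B s \<omega> \<in> {z. l \<le> \<bar>z $ i\<bar>}}"
  have E: "E = {\<omega> \<in> space M. l \<le> \<bar>inc s t i \<omega>\<bar>}" by (auto simp: E_def)
  have E_M: "E \<in> events" using s st unfolding E by (measurable, auto)
  have A_M: "A \<in> events" using A sets_F s by blast
  have "{\<omega> \<in> A. \<exists>r\<in>D. 2 * l \<le> \<bar>inc s r i \<omega>\<bar>} = (\<Union>r\<in>D. T r)"
  proof (intro equalityI subsetI)
    fix \<omega> assume "\<omega> \<in> {\<omega> \<in> A. \<exists>r\<in>D. 2 * l \<le> \<bar>inc s r i \<omega>\<bar>}"
    then have w: "\<omega> \<in> A" "{r\<in>D. 2 * l \<le> \<bar>inc s r i \<omega>\<bar>} \<noteq> {}" by auto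
    let ?m = "Min {r\<in>D. 2 * l \<le> \<bar>inc s r i \<omega>\<bar>}"
    have "?m \<in> {r\<in>D. 2 * l \<le> \<bar>inc s r i \<omega>\<bar>}" by (rule Min_in) (use D w in auto)
    moreover have "?m \<le> q" if "q \<in> D" "2 * l \<le> \<bar>inc s q i \<omega>\<bar>" for q
      by (rule Min_le) (use D that in simp_all)
    ultimately have "\<omega> \<in> T ?m" "?m \<in> D" using w by (auto simp: T_def not_le[symmetric] dest: leD)
    then show "\<omega> \<in> (\<Union>r\<in>D. T r)" by blast
  qed (auto simp: T_def)
  then have "prob {\<omega> \<in> A. \<exists>r\<in>D. 2 * l \<le> \<bar>inc s r i \<omega>\<bar>} = prob (\<Union>r\<in>D. T r)" by simp
  also have "\<dots> \<le> (\<Sum>r\<in>D. prob (T r))"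
    using D T_M by (intro finite_measure_subadditive_finite) auto
  also have "\<dots> \<le> (\<Sum>r\<in>D. 2 * prob (T r \<inter> G r))" by (intro sum_mono half)
  also have "\<dots> = 2 * prob (\<Union>r\<in>D. T r \<inter> G r)"
    using D T_M G_M disj by (subst finite_measure_finite_Union) (auto simp: sum_distrib_left)
  also have "(\<Union>r\<in>D. T r \<inter> G r) \<subseteq> A \<inter> E"
    using A_sub by (auto simp: T_def G_def E)
  then have "2 * prob (\<Union>r\<in>D. T r \<inter> G r) \<le> 2 * prob (A \<inter> E)"
    using E_M A_M by (intro mult_left_mono finite_measure_mono) auto
  also have "prob (A \<inter> E) = prob A * prob E"
    unfolding E_def using A s st by (intro independent_increment) (auto intro!: borel_closed closed_Collect_le continuous_intros)
  also have "2 * (prob A * prob E) \<le> 2 * (prob A * ((t - s) / l\<^sup>2))"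
    using increment_tail[OF s st l, of i] by (intro mult_left_mono) (auto simp: E)
  also have "2 * (prob A * ((t - s) / l\<^sup>2)) = 2 * (t - s) / l\<^sup>2 * prob A" by simp
  finally show ?thesis .
qed


text \<open>
  Given the past, the increment falls in a prescribed orthant, one standard deviation away from
  its walls, with probability at least \<open>normal_exceedance_bound ^ CARD('n)\<close>. Over a short step a large
  oscillation has a conditional probability of at most half of that.
\<close>

lemma controlled_step:
  assumes s: "0 \<le> s" "s < t" and D: "finite D" "D \<subseteq> {s..t}" and A: "A \<in> sets (F s)"
    and \<delta>: "0 < \<delta>" and small: "4 * (t - s) / \<delta>\<^sup>2 \<le> 1 / 2"
    and small': "8 * real CARD('n) * (t - s) / \<delta>\<^sup>2 \<le> normal_exceedance_bound ^ CARD('n) / 2"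
  shows "normal_exceedance_bound ^ CARD('n) / 2 * prob A
    \<le> prob {\<omega> \<in> A. (\<forall>i. if \<tau> i then inc s t i \<omega> \<le> - sqrt (t - s) else sqrt (t - s) \<le> inc s t i \<omega>)
                  \<and> (\<forall>r\<in>D. \<forall>i. \<bar>inc s r i \<omega>\<bar> < \<delta>)}"
proof -
  let ?C = "{z :: real ^ 'n. \<forall>i. if \<tau> i then z $ i \<le> - sqrt (t - s) else sqrt (t - s) \<le> z $ i}"
  let ?E = "{\<omega> \<in> space M. B t \<omega> - B s \<omega> \<in> ?C}"
  let ?bad = "\<lambda>i. {\<omega> \<in> A. \<exists>r\<in>D. 2 * (\<delta> / 2) \<le> \<bar>inc s r i \<omega>\<bar>}"
  let ?good = "{\<omega> \<in> A. (\<forall>i. if \<tau> i then inc s t i \<omega> \<le> - sqrt (t - s) else sqrt (t - s) \<le> inc s t i \<omega>)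
                  \<and> (\<forall>r\<in>D. \<forall>i. \<bar>inc s r i \<omega>\<bar> < \<delta>)}"
  have A_sub: "A \<subseteq> space M" using sets.sets_into_space[OF A] space_F s by simp
  have A_M: "A \<in> events" using A sets_F[OF s(1)] by (rule set_rev_mp)
  have "?C = (\<Inter>i. if \<tau> i then {z. z $ i \<le> - sqrt (t - s)} else {z. sqrt (t - s) \<le> z $ i})"
    by (auto split: if_splits)
  also have "closed \<dots>"
    by (intro closed_INT ballI) (simp add: closed_Collect_le continuous_on_component)
  finally have C: "?C \<in> sets borel" by (rule borel_closed)
  have E_M: "?E \<in> events"
  proof -
    have [measurable]: "B t \<in> borel_measurable M" "B s \<in> borel_measurable M" using B_measurable s by auto
    have "(\<lambda>\<omega>. B t \<omega> - B s \<omega>) \<in> borel_measurable M" by (rule borel_measurable_diff) fact+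
    from measurable_sets[OF this C] show ?thesis by (simp add: vimage_def Int_def conj_commute)
  qed
  have inc_M: "(\<lambda>\<omega>. inc s r i \<omega>) \<in> borel_measurable M" if "r \<in> D" for r i
    using that D s by (intro borel_measurable_diff B_component_measurable) auto
  have A_Coll: "{\<omega> \<in> space M. \<omega> \<in> A \<and> P \<omega>} = {\<omega> \<in> A. P \<omega>}" for P using A_sub by auto
  have A_all: "{\<omega> \<in> space M. \<omega> \<in> A} \<in> events" using A_M A_sub by (simp add: Int_absorb1 Int_def[symmetric] flip: Collect_conj_eq)
  have bad_M: "?bad i \<in> events" for i
  proof -
    have "{\<omega> \<in> space M. \<omega> \<in> A \<and> (\<exists>r\<in>D. 2 * (\<delta> / 2) \<le> \<bar>inc s r i \<omega>\<bar>)} \<in> events"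
    proof (intro sets.sets_Collect_conj sets.sets_Collect_finite_Ex A_all)
      fix r assume "r \<in> D"
      note [measurable] = inc_M[OF this, of i]
      show "{\<omega> \<in> space M. 2 * (\<delta> / 2) \<le> \<bar>inc s r i \<omega>\<bar>} \<in> events" by measurable
    qed (use D in auto)
    then show ?thesis unfolding A_Coll .
  qed
  have good_eq: "?good = (A \<inter> ?E) - (\<Union>i. ?bad i)"
    using A_sub by (auto simp: not_le) (metis not_le)+
  have E_eq: "?E = {\<omega> \<in> space M. \<forall>i. if \<tau> i then inc s t i \<omega> \<le> - sqrt (t - s) else sqrt (t - s) \<le> inc s t i \<omega>}"
    by (auto split: if_splits)
  have "normal_exceedance_bound ^ CARD('n) \<le> prob ?E" unfolding E_eq by (rule increment_orthant[OF s])
  then have "normal_exceedance_bound ^ CARD('n) * prob A \<le> prob A * prob ?E"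
    by (subst mult.commute) (rule mult_left_mono, simp_all)
  also have "\<dots> = prob (A \<inter> ?E)" by (rule independent_increment[OF s A C, symmetric])
  also have "\<dots> \<le> prob (?good \<union> (\<Union>i. ?bad i))"
    using A_M E_M bad_M unfolding good_eq by (intro finite_measure_mono) auto
  also have "\<dots> \<le> prob ?good + prob (\<Union>i. ?bad i)"
    using A_M E_M bad_M unfolding good_eq by (intro measure_Un_le) auto
  also have "prob (\<Union>i. ?bad i) \<le> (\<Sum>i\<in>UNIV. prob (?bad i))"
    using bad_M by (intro finite_measure_subadditive_finite) auto
  also have "\<dots> \<le> (\<Sum>i\<in>(UNIV::'n set). 2 * (t - s) / (\<delta> / 2)\<^sup>2 * prob A)"
  proof (rule sum_mono)
    fix i
    have "(t - s) / (\<delta> / 2)\<^sup>2 \<le> 1 / 2" using small by (simp add: power_divide field_simps)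
    then show "prob (?bad i) \<le> 2 * (t - s) / (\<delta> / 2)\<^sup>2 * prob A"
      using \<delta> by (intro ottaviani[OF s(1) D A _ _ s(2)]) auto
  qed
  also have "\<dots> = 8 * real CARD('n) * (t - s) / \<delta>\<^sup>2 * prob A"
    by (simp add: power_divide)
  also have "\<dots> \<le> normal_exceedance_bound ^ CARD('n) / 2 * prob A" using small' by (rule mult_right_mono) simp
  finally show ?thesis by linarith
qed


text \<open>
  The orthant may depend on the past: split \<open>A\<close> into the finitely many events on which the
  required signs are constant.
\<close>

lemma adapted_controlled_step:
  assumes s: "0 \<le> s" "s < t" and D: "finite D" "D \<subseteq> {s..t}" and A: "A \<in> sets (F s)"
    and \<delta>: "0 < \<delta>" and small: "4 * (t - s) / \<delta>\<^sup>2 \<le> 1 / 2"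
    and small': "8 * real CARD('n) * (t - s) / \<delta>\<^sup>2 \<le> normal_exceedance_bound ^ CARD('n) / 2"
    and T: "\<And>i. {\<omega> \<in> space M. T i \<omega>} \<in> sets (F s)"
  shows "normal_exceedance_bound ^ CARD('n) / 2 * prob A
    \<le> prob {\<omega> \<in> A. (\<forall>i. if T i \<omega> then inc s t i \<omega> \<le> - sqrt (t - s) else sqrt (t - s) \<le> inc s t i \<omega>)
                  \<and> (\<forall>r\<in>D. \<forall>i. \<bar>inc s r i \<omega>\<bar> < \<delta>)}"
    (is "_ \<le> prob ?G")
proof -
  define A' where "A' \<tau> = {\<omega> \<in> space M. \<omega> \<in> A \<and> (\<forall>i. T i \<omega> \<longleftrightarrow> \<tau> i)}" for \<tau> :: "'n \<Rightarrow> bool"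
  let ?G' = "\<lambda>\<tau>. {\<omega> \<in> A' \<tau>. (\<forall>i. if \<tau> i then inc s t i \<omega> \<le> - sqrt (t - s) else sqrt (t - s) \<le> inc s t i \<omega>)
                  \<and> (\<forall>r\<in>D. \<forall>i. \<bar>inc s r i \<omega>\<bar> < \<delta>)}"
  have A_sub: "A \<subseteq> space M" using sets.sets_into_space[OF A] space_F s by simp
  have A'_F: "A' \<tau> \<in> sets (F s)" for \<tau>
  proof -
    have "{\<omega> \<in> space M. T i \<omega> \<longleftrightarrow> \<tau> i} \<in> sets (F s)" for i
    proof (cases "\<tau> i")
      case False
      have "{\<omega> \<in> space M. T i \<omega> \<longleftrightarrow> \<tau> i} = space (F s) - {\<omega> \<in> space M. T i \<omega>}"
        using False space_F s by auto
      then show ?thesis using T[of i] by (metis sets.compl_sets)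
    qed (use T[of i] in simp)
    then have "A \<inter> (\<Inter>i. {\<omega> \<in> space M. T i \<omega> \<longleftrightarrow> \<tau> i}) \<in> sets (F s)"
      using A by (intro sets.Int sets.finite_INT) auto
    moreover have "A' \<tau> = A \<inter> (\<Inter>i. {\<omega> \<in> space M. T i \<omega> \<longleftrightarrow> \<tau> i})"
      using A_sub by (auto simp: A'_def)
    ultimately show ?thesis by simp
  qed
  have A'_M: "A' \<tau> \<in> events" for \<tau> using A'_F sets_F[OF s(1)] by blast
  have G'_M: "?G' \<tau> \<in> events" for \<tau>
  proof -
    have inc_M: "(\<lambda>\<omega>. inc s r i \<omega>) \<in> borel_measurable M" if "0 \<le> r" for r i
      using that s by (intro borel_measurable_diff B_component_measurable) auto
    have "{\<omega> \<in> space M. (\<forall>i\<in>UNIV. if \<tau> i then inc s t i \<omega> \<le> - sqrt (t - s) else sqrt (t - s) \<le> inc s t i \<omega>)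
                  \<and> (\<forall>r\<in>D. \<forall>i\<in>UNIV. \<bar>inc s r i \<omega>\<bar> < \<delta>)} \<in> events"
    proof (intro sets.sets_Collect_conj sets.sets_Collect_finite_All)
      fix i
      have "0 \<le> t" using s by simp
      note [measurable] = inc_M[OF this, of i]
      show "{\<omega> \<in> space M. if \<tau> i then inc s t i \<omega> \<le> - sqrt (t - s) else sqrt (t - s) \<le> inc s t i \<omega>} \<in> events"
        by (cases "\<tau> i") simp_all
    next
      fix r i assume "r \<in> D"
      then have "0 \<le> r" using D s by auto
      note [measurable] = inc_M[OF this, of i]
      show "{\<omega> \<in> space M. \<bar>inc s r i \<omega>\<bar> < \<delta>} \<in> events" by measurable
    qed (use D in auto)
    then have "A' \<tau> \<inter> {\<omega> \<in> space M. (\<forall>i\<in>UNIV. if \<tau> i then inc s t i \<omega> \<le> - sqrt (t - s) else sqrt (t - s) \<le> inc s t i \<omega>)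
                  \<and> (\<forall>r\<in>D. \<forall>i\<in>UNIV. \<bar>inc s r i \<omega>\<bar> < \<delta>)} \<in> events" (is "?S \<in> _")
      using A'_M by (rule sets.Int[rotated])
    moreover have "?S = ?G' \<tau>" by (auto simp: A'_def)
    ultimately show ?thesis by simp
  qed
  have "A = (\<Union>\<tau>. A' \<tau>)" using A_sub by (auto simp: A'_def)
  then have "prob A = prob (\<Union>\<tau>. A' \<tau>)" by (rule arg_cong)
  also have "\<dots> = (\<Sum>\<tau>\<in>UNIV. prob (A' \<tau>))"
  proof (rule finite_measure_finite_Union)
    show "disjoint_family A'" unfolding disjoint_family_on_def A'_def by (auto simp: fun_eq_iff)
  qed (use A'_M in auto)
  finally have "prob A = (\<Sum>\<tau>\<in>UNIV. prob (A' \<tau>))" .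
  then have "normal_exceedance_bound ^ CARD('n) / 2 * prob A = (\<Sum>\<tau>\<in>UNIV. normal_exceedance_bound ^ CARD('n) / 2 * prob (A' \<tau>))"
    by (simp add: sum_distrib_left)
  also have "\<dots> \<le> (\<Sum>\<tau>\<in>UNIV. prob (?G' \<tau>))"
    by (rule sum_mono) (rule controlled_step[OF s D A'_F \<delta> small small'])
  also have "\<dots> = prob (\<Union>\<tau>. ?G' \<tau>)"
  proof (rule finite_measure_finite_Union[symmetric])
    show "disjoint_family ?G'" unfolding disjoint_family_on_def
    proof (intro ballI impI)
      fix \<tau> \<tau>' :: "'n \<Rightarrow> bool" assume "\<tau> \<noteq> \<tau>'"
      then have "A' \<tau> \<inter> A' \<tau>' = {}" by (auto simp: A'_def fun_eq_iff)
      then show "?G' \<tau> \<inter> ?G' \<tau>' = {}" by auto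
    qed
    show "range ?G' \<subseteq> events" by (rule image_subsetI) (rule G'_M)
  qed simp
  also have "(\<Union>\<tau>. ?G' \<tau>) = ?G"
    using A_sub by (auto simp: A'_def)
  finally show ?thesis .
qed

text \<open>
  Feedback control. With \<open>e = B - w\<close>, the event \<open>A k\<close> below keeps \<open>|e| \<le> 4 \<delta>\<close> up to the \<open>k\<close>-th step
  and \<open>|e| \<le> 2 \<delta>\<close> at its end. An increment of size at least \<open>\<surd>h \<ge> m h\<close> and of sign opposite to the
  error moves the error towards (or past) zero by at most \<open>2 \<delta>\<close>, so the bound \<open>2 \<delta>\<close> persists. The
  resulting lower bound does not depend on \<open>D\<close>.
\<close>

lemma prob_near_lipschitz_path_on_finite_set:
  fixes w :: "real \<Rightarrow> real ^ 'n"
  assumes w0: "w 0 = 0" and m: "0 \<le> m"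
    and w: "\<And>r s i. 0 \<le> r \<Longrightarrow> r \<le> s \<Longrightarrow> s \<le> real n * h \<Longrightarrow> \<bar>w s $ i - w r $ i\<bar> \<le> m * (s - r)"
    and h: "0 < h" and \<delta>: "0 < \<delta>"
    and small: "4 * h / \<delta>\<^sup>2 \<le> 1 / 2" "8 * real CARD('n) * h / \<delta>\<^sup>2 \<le> normal_exceedance_bound ^ CARD('n) / 2"
    and mh: "m * h \<le> sqrt h" "m * h \<le> \<delta>"
    and D: "finite D" "D \<subseteq> {0..real n * h}"
  shows "(normal_exceedance_bound ^ CARD('n) / 2) ^ n \<le> prob {\<omega> \<in> space M. \<forall>r\<in>D. \<forall>i. \<bar>B r \<omega> $ i - w r $ i\<bar> \<le> 4 * \<delta>}"
proof -
  let ?\<kappa> = "normal_exceedance_bound ^ CARD('n) / 2"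
  define e where "e r i \<omega> = B r \<omega> $ i - w r $ i" for r i \<omega>
  define A where "A k = {\<omega> \<in> space M. (\<forall>r\<in>{r\<in>D. r \<le> real k * h}. \<forall>i\<in>UNIV. \<bar>e r i \<omega>\<bar> \<le> 4 * \<delta>)
      \<and> (\<forall>i\<in>UNIV. \<bar>e (real k * h) i \<omega>\<bar> \<le> 2 * \<delta>)}" for k
  have e_F: "(\<lambda>\<omega>. e r i \<omega>) \<in> borel_measurable (F s)" if "0 \<le> r" "r \<le> s" for r s i
    unfolding e_def using that by (intro borel_measurable_diff B_component_measurable_F) auto
  have A_F: "A k \<in> sets (F (real k * h))" for k
  proof -
    have k: "0 \<le> real k * h" using h by simp
    have "{\<omega> \<in> space (F (real k * h)). (\<forall>r\<in>{r\<in>D. r \<le> real k * h}. \<forall>i\<in>UNIV. \<bar>e r i \<omega>\<bar> \<le> 4 * \<delta>)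
      \<and> (\<forall>i\<in>UNIV. \<bar>e (real k * h) i \<omega>\<bar> \<le> 2 * \<delta>)} \<in> sets (F (real k * h))"
    proof (intro sets.sets_Collect_conj sets.sets_Collect_finite_All)
      fix r i assume "r \<in> {r\<in>D. r \<le> real k * h}"
      then have "0 \<le> r" "r \<le> real k * h" using D by auto
      note [measurable] = e_F[OF this, of i]
      show "{\<omega> \<in> space (F (real k * h)). \<bar>e r i \<omega>\<bar> \<le> 4 * \<delta>} \<in> sets (F (real k * h))" by measurable
    next
      fix i
      note [measurable] = e_F[OF k order_refl, of i]
      show "{\<omega> \<in> space (F (real k * h)). \<bar>e (real k * h) i \<omega>\<bar> \<le> 2 * \<delta>} \<in> sets (F (real k * h))" by measurable
    qed (use D in auto)
    then show ?thesis unfolding A_def using space_F[OF k] by simp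
  qed
  have A_M: "A k \<in> events" for k using A_F[of k] sets_F[of "real k * h"] h by (metis in_mono less_imp_le mult_nonneg_nonneg of_nat_0_le_iff)
  have "?\<kappa> ^ k \<le> prob (A k)" if "k \<le> n" for k
    using that
  proof (induction k)
    case 0
    have "AE \<omega> in M. B 0 \<omega> = 0" using brownian by (simp add: brownian_motion_def)
    with AE_space have "AE \<omega> in M. \<omega> \<in> A 0"
    proof eventually_elim
      case (elim \<omega>)
      have "e r i \<omega> = 0" if "r \<in> D" "r \<le> 0" for r i
      proof -
        have "r = 0" using that D by force
        then show ?thesis using elim w0 by (simp add: e_def)
      qed
      moreover have "e 0 i \<omega> = 0" for i using elim w0 by (simp add: e_def)
      ultimately show ?case using \<delta> elim by (simp add: A_def)
    qed
    then have "prob (A 0) = 1" using A_M by (simp add: prob_eq_1)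
    then show ?case by simp
  next
    case (Suc k)
    define s t where "s = real k * h" and "t = real (Suc k) * h"
    have st: "0 \<le> s" "s < t" "t - s = h" using h by (auto simp: s_def t_def algebra_simps)
    have tn: "t \<le> real n * h" unfolding t_def using Suc.prems h by (intro mult_right_mono) auto
    define D' where "D' = insert t {r\<in>D. s \<le> r \<and> r \<le> t}"
    have D': "finite D'" "D' \<subseteq> {s..t}" using D st by (auto simp: D'_def)
    let ?G = "{\<omega> \<in> A k. (\<forall>i. if 0 < e s i \<omega> then inc s t i \<omega> \<le> - sqrt (t - s) else sqrt (t - s) \<le> inc s t i \<omega>)
                  \<and> (\<forall>r\<in>D'. \<forall>i. \<bar>inc s r i \<omega>\<bar> < \<delta>)}"
    have "?\<kappa> * prob (A k) \<le> prob ?G"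
    proof (rule adapted_controlled_step[OF st(1,2) D' _ \<delta>])
      show "A k \<in> sets (F s)" using A_F by (simp add: s_def)
      show "{\<omega> \<in> space M. 0 < e s i \<omega>} \<in> sets (F s)" for i
      proof -
        note [measurable] = e_F[OF st(1) order_refl, of i]
        have "{\<omega> \<in> space (F s). 0 < e s i \<omega>} \<in> sets (F s)" by measurable
        then show ?thesis using space_F[OF st(1)] by simp
      qed
    qed (use small st in auto)
    also have "?G \<subseteq> A (Suc k)"
    proof
      fix \<omega> assume G: "\<omega> \<in> ?G"
      then have Ak: "\<omega> \<in> A k" by simp
      have es: "\<bar>e s i \<omega>\<bar> \<le> 2 * \<delta>" for i using Ak by (auto simp: A_def s_def)
      have small_inc: "\<bar>inc s r i \<omega>\<bar> < \<delta>" if "r \<in> D'" for r i using G that by auto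
      have w_inc: "\<bar>w r $ i - w s $ i\<bar> \<le> m * h" if "s \<le> r" "r \<le> t" for r i
      proof -
        have "\<bar>w r $ i - w s $ i\<bar> \<le> m * (r - s)" by (rule w) (use that st tn in auto)
        also have "\<dots> \<le> m * h" using that st m by (intro mult_left_mono) auto
        finally show ?thesis .
      qed
      have e_inc: "e r i \<omega> = e s i \<omega> + inc s r i \<omega> - (w r $ i - w s $ i)" for r i by (simp add: e_def)
      have 1: "\<bar>e r i \<omega>\<bar> \<le> 4 * \<delta>" if r: "r \<in> D" "r \<le> t" for r i
      proof (cases "r \<le> s")
        case True
        then show ?thesis using Ak r by (auto simp: A_def s_def)
      next
        case False
        then have "r \<in> D'" using r by (simp add: D'_def)
        then show ?thesis using es[of i] small_inc[of r i] w_inc[of r i] e_inc[of r i] False r mh by linarith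
      qed
      have 2: "\<bar>e t i \<omega>\<bar> \<le> 2 * \<delta>" for i
      proof -
        have "t \<in> D'" by (simp add: D'_def)
        moreover have "if 0 < e s i \<omega> then inc s t i \<omega> \<le> - sqrt h else sqrt h \<le> inc s t i \<omega>"
          using G st by auto
        ultimately show ?thesis
          using es[of i] small_inc[of t i] w_inc[of t i] e_inc[of t i] mh st by (cases "0 < e s i \<omega>") simp_all
      qed
      from 1 2 show "\<omega> \<in> A (Suc k)" using Ak unfolding A_def t_def by auto
    qed
    then have "prob ?G \<le> prob (A (Suc k))" using A_M by (intro finite_measure_mono)
    finally have "?\<kappa> * prob (A k) \<le> prob (A (Suc k))" .
    moreover have "?\<kappa> * ?\<kappa> ^ k \<le> ?\<kappa> * prob (A k)" using Suc normal_exceedance_bound_pos by (intro mult_left_mono) auto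
    ultimately show ?case by simp
  qed
  then have "?\<kappa> ^ n \<le> prob (A n)" by simp
  also have "\<dots> \<le> prob {\<omega> \<in> space M. \<forall>r\<in>D. \<forall>i\<in>UNIV. \<bar>e r i \<omega>\<bar> \<le> 4 * \<delta>}"
  proof (rule finite_measure_mono)
    show "A n \<subseteq> {\<omega> \<in> space M. \<forall>r\<in>D. \<forall>i\<in>UNIV. \<bar>e r i \<omega>\<bar> \<le> 4 * \<delta>}" using D by (auto simp: A_def)
    show "{\<omega> \<in> space M. \<forall>r\<in>D. \<forall>i\<in>UNIV. \<bar>e r i \<omega>\<bar> \<le> 4 * \<delta>} \<in> events"
    proof (intro sets.sets_Collect_finite_All)
      fix r i assume "r \<in> D"
      then have r: "0 \<le> r" using D by auto
      have [measurable]: "(\<lambda>\<omega>. e r i \<omega>) \<in> borel_measurable M"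
        unfolding e_def by (intro borel_measurable_diff B_component_measurable r) simp
      show "{\<omega> \<in> space M. \<bar>e r i \<omega>\<bar> \<le> 4 * \<delta>} \<in> events" by measurable
    qed (use D in auto)
  qed
  finally show ?thesis by (simp add: e_def)
qed

text \<open>
  The bound for finite sets is uniform, so it passes to a countable set by monotone
  convergence. The step number is chosen to make \<open>h = T / n\<close> small.
\<close>

lemma prob_near_lipschitz_path:
  fixes w :: "real \<Rightarrow> real ^ 'n"
  assumes T: "0 < T" and w0: "w 0 = 0" and m: "0 \<le> m"
    and w: "\<And>r s i. 0 \<le> r \<Longrightarrow> r \<le> s \<Longrightarrow> s \<le> T \<Longrightarrow> \<bar>w s $ i - w r $ i\<bar> \<le> m * (s - r)"
    and \<delta>: "0 < \<delta>" and Q: "Q \<subseteq> {0..T}" "countable Q" "Q \<noteq> {}"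
  shows "0 < prob {\<omega> \<in> space M. \<forall>r\<in>Q. \<forall>i. \<bar>B r \<omega> $ i - w r $ i\<bar> \<le> 4 * \<delta>}"
    and "{\<omega> \<in> space M. \<forall>r\<in>Q. \<forall>i. \<bar>B r \<omega> $ i - w r $ i\<bar> \<le> 4 * \<delta>} \<in> events"
proof -
  let ?h = "\<lambda>n. T / real n" and ?\<kappa> = "normal_exceedance_bound ^ CARD('n) / 2"
  have \<kappa>: "0 < ?\<kappa>" using normal_exceedance_bound_pos by simp
  have h: "?h \<longlonglongrightarrow> 0" by (rule lim_const_over_n)
  have lim1: "(\<lambda>n. 4 * ?h n / \<delta>\<^sup>2) \<longlonglongrightarrow> 4 * 0 / \<delta>\<^sup>2"
    by (intro tendsto_intros h) (use \<delta> in auto)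
  have lim2: "(\<lambda>n. 8 * real CARD('n) * ?h n / \<delta>\<^sup>2) \<longlonglongrightarrow> 8 * real CARD('n) * 0 / \<delta>\<^sup>2"
    by (intro tendsto_intros h) (use \<delta> in auto)
  have lim3: "(\<lambda>n. m * sqrt (?h n)) \<longlonglongrightarrow> m * sqrt 0" by (intro tendsto_intros h)
  have lim4: "(\<lambda>n. m * ?h n) \<longlonglongrightarrow> m * 0" by (intro tendsto_intros h)
  have "\<forall>\<^sub>F n in sequentially. 0 < n \<and> 4 * ?h n / \<delta>\<^sup>2 < 1 / 2 \<and> 8 * real CARD('n) * ?h n / \<delta>\<^sup>2 < ?\<kappa>
      \<and> m * sqrt (?h n) < 1 \<and> m * ?h n < \<delta>"
    using \<kappa> \<delta> by (intro eventually_conj eventually_gt_at_top order_tendstoD(2)[OF lim1]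
        order_tendstoD(2)[OF lim2] order_tendstoD(2)[OF lim3] order_tendstoD(2)[OF lim4]) auto
  then obtain n where n: "0 < n" "4 * ?h n / \<delta>\<^sup>2 < 1 / 2" "8 * real CARD('n) * ?h n / \<delta>\<^sup>2 < ?\<kappa>"
      "m * sqrt (?h n) < 1" "m * ?h n < \<delta>"
    by (metis (mono_tags, lifting) eventually_happens sequentially_bot)
  have hn: "0 < ?h n" using T n by simp
  have nh: "real n * ?h n = T" using n by simp
  have msq: "m * ?h n \<le> sqrt (?h n)"
  proof -
    have "m * ?h n = (m * sqrt (?h n)) * sqrt (?h n)"
      using hn by (metis abs_of_pos mult.assoc real_sqrt_mult_self)
    also have "\<dots> \<le> 1 * sqrt (?h n)" using n hn by (intro mult_right_mono) auto
    finally show ?thesis by simp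
  qed
  define G where "G D = {\<omega> \<in> space M. \<forall>r\<in>D. \<forall>i\<in>UNIV. \<bar>B r \<omega> $ i - w r $ i\<bar> \<le> 4 * \<delta>}" for D
  have G_ge: "?\<kappa> ^ n \<le> prob (G D)" if "finite D" "D \<subseteq> {0..T}" for D
    unfolding G_def ball_UNIV
    by (rule prob_near_lipschitz_path_on_finite_set[where w = w and m = m and n = n and h = "?h n" and \<delta> = \<delta>,
          OF w0 m _ hn \<delta> _ _ msq])
      (use w n that nh in auto)
  have G_M: "G D \<in> events" if "finite D" "D \<subseteq> {0..T}" for D
    unfolding G_def
  proof (intro sets.sets_Collect_finite_All)
    fix r i assume "r \<in> D"
    then have r: "0 \<le> r" using that by auto
    have [measurable]: "(\<lambda>\<omega>. B r \<omega> $ i - w r $ i) \<in> borel_measurable M"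
      by (intro borel_measurable_diff B_component_measurable r) simp
    show "{\<omega> \<in> space M. \<bar>B r \<omega> $ i - w r $ i\<bar> \<le> 4 * \<delta>} \<in> events" by measurable
  qed (use that in auto)
  define D where "D k = from_nat_into Q ` {..<k}" for k
  have D: "finite (D k)" "D k \<subseteq> {0..T}" for k
    using Q from_nat_into[OF Q(3)] by (auto simp: D_def)
  have Q_eq: "Q = (\<Union>k. D k)"
    using range_from_nat_into[OF Q(3,2)] by (auto simp: D_def)
  have "G Q = (\<Inter>k. G (D k))" unfolding Q_eq by (auto simp: G_def)
  moreover have "(\<lambda>k. prob (G (D k))) \<longlonglongrightarrow> prob (\<Inter>k. G (D k))"
  proof (rule finite_Lim_measure_decseq)
    show "range (\<lambda>k. G (D k)) \<subseteq> events" using G_M D by auto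
    show "decseq (\<lambda>k. G (D k))" by (auto simp: decseq_def G_def D_def)
  qed
  moreover have "(\<Inter>k. G (D k)) \<in> events" using G_M D by (intro sets.countable_INT) auto
  ultimately have "?\<kappa> ^ n \<le> prob (G Q)" "G Q \<in> events"
    using G_ge[OF D] by (auto intro: LIMSEQ_le_const)
  moreover have "0 < ?\<kappa> ^ n" using \<kappa> by simp
  ultimately have "0 < prob (G Q)" "G Q \<in> events" by linarith+
  then show "0 < prob {\<omega> \<in> space M. \<forall>r\<in>Q. \<forall>i. \<bar>B r \<omega> $ i - w r $ i\<bar> \<le> 4 * \<delta>}"
    and "{\<omega> \<in> space M. \<forall>r\<in>Q. \<forall>i. \<bar>B r \<omega> $ i - w r $ i\<bar> \<le> 4 * \<delta>} \<in> events"
    by (simp_all add: G_def)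
qed

text \<open>
  Polynomials are Lipschitz on bounded intervals and uniformly dense in the continuous paths.
\<close>

lemma full_support:
  fixes w :: "real \<Rightarrow> real ^ 'n"
  assumes T: "0 < T" and w: "continuous_on {0..T} w" and w0: "w 0 = 0" and \<epsilon>: "0 < \<epsilon>"
  obtains E where "E \<in> events" "0 < prob E"
    "\<And>\<omega> r. \<omega> \<in> E \<Longrightarrow> continuous_on {0..} (\<lambda>t. B t \<omega>) \<Longrightarrow> r \<in> {0..T} \<Longrightarrow> norm (B r \<omega> - w r) \<le> \<epsilon>"
proof -
  obtain g where g: "polynomial_function g" and gw: "\<And>x. x \<in> {0..T} \<Longrightarrow> norm (w x - g x) < \<epsilon> / 4"
    using Stone_Weierstrass_polynomial_function[OF compact_Icc w, of "\<epsilon> / 4"] \<epsilon> by auto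
  obtain g' where g': "polynomial_function g'" "\<And>x. (g has_vector_derivative (g' x)) (at x)"
    using has_vector_derivative_polynomial_function[OF g] by blast
  have "continuous_on {0..T} g'" by (rule continuous_on_polymonial_function[OF g'(1)])
  then have "bounded (g' ` {0..T})" by (intro compact_imp_bounded compact_continuous_image compact_Icc)
  then obtain m where m: "0 < m" "\<And>x. x \<in> {0..T} \<Longrightarrow> norm (g' x) \<le> m"
    unfolding bounded_pos by auto
  define u where "u r = g r - g 0" for r
  have lip: "\<bar>u s $ i - u r $ i\<bar> \<le> m * (s - r)" if "0 \<le> r" "r \<le> s" "s \<le> T" for r s i
  proof -
    have "norm (g s - g r) \<le> m * norm (s - r)"
    proof (rule differentiable_bound[where S = "{0..T}" and f' = "\<lambda>x h. h *\<^sub>R g' x"])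
      show "(g has_derivative (\<lambda>h. h *\<^sub>R g' x)) (at x within {0..T})" for x
        using has_vector_derivative_at_within[OF g'(2)] by (simp add: has_vector_derivative_def)
      show "onorm (\<lambda>h. h *\<^sub>R g' x) \<le> m" if "x \<in> {0..T}" for x
        using m(2)[OF that] onorm_scaleR_left[OF bounded_linear_ident, of "g' x"] by (simp add: onorm_id)
    qed (use that in auto)
    moreover have "\<bar>u s $ i - u r $ i\<bar> \<le> norm (g s - g r)"
      using component_le_norm_cart[of "g s - g r" i] by (simp add: u_def)
    ultimately show ?thesis using that by simp
  qed
  define \<delta> where "\<delta> = \<epsilon> / (8 * real CARD('n))"
  have \<delta>: "0 < \<delta>" using \<epsilon> by (simp add: \<delta>_def)
  \<comment> \<open>The open interval is used because its intersection with the rationals is dense in \<open>{0..T}\<close>.\<close>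
  define Q where "Q = {0<..<T} \<inter> \<rat>"
  have Q: "Q \<subseteq> {0..T}" "countable Q" "Q \<noteq> {}"
    using Rats_dense_in_real[OF T] countable_rat by (auto simp: Q_def intro: countable_subset)
  have cl: "closure Q = {0..T}"
    unfolding Q_def using closure_open_Int_superset[of "{0<..<T}" \<rat>] T by (simp add: Rats_closure_real)
  define E where "E = {\<omega> \<in> space M. \<forall>r\<in>Q. \<forall>i. \<bar>B r \<omega> $ i - u r $ i\<bar> \<le> 4 * \<delta>}"
  show ?thesis
  proof (rule that[of E])
    show "E \<in> events" "0 < prob E"
      unfolding E_def by (rule prob_near_lipschitz_path[OF T _ _ lip \<delta> Q]; use m in \<open>simp add: u_def\<close>)+
    fix \<omega> r assume \<omega>: "\<omega> \<in> E" and cont: "continuous_on {0..} (\<lambda>t. B t \<omega>)" and r: "r \<in> {0..T}"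
    have "norm (B q \<omega> - u q) \<le> \<epsilon> / 2" if "q \<in> Q" for q
    proof -
      have "norm (B q \<omega> - u q) \<le> (\<Sum>i\<in>UNIV. \<bar>(B q \<omega> - u q) $ i\<bar>)" by (rule norm_le_l1_cart)
      also have "\<dots> \<le> (\<Sum>i\<in>(UNIV :: 'n set). 4 * \<delta>)"
        using \<omega> that by (intro sum_mono) (auto simp: E_def)
      also have "\<dots> = \<epsilon> / 2" by (simp add: \<delta>_def)
      finally show ?thesis .
    qed
    moreover have "continuous_on (closure Q) (\<lambda>q. B q \<omega> - u q)"
      unfolding cl u_def
      by (intro continuous_intros continuous_on_subset[OF cont] continuous_on_polymonial_function g) auto
    ultimately have "norm (B r \<omega> - u r) \<le> \<epsilon> / 2"
      using r cl by (intro continuous_on_closure_norm_le[of Q "\<lambda>q. B q \<omega> - u q"]) auto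
    moreover have "norm (u r - w r) \<le> \<epsilon> / 4 + \<epsilon> / 4"
    proof -
      have "u r - w r = (w 0 - g 0) - (w r - g r)" using w0 by (simp add: u_def)
      then have "norm (u r - w r) \<le> norm (w 0 - g 0) + norm (w r - g r)"
        by (metis norm_triangle_ineq4)
      moreover have "norm (w 0 - g 0) < \<epsilon> / 4" "norm (w r - g r) < \<epsilon> / 4" using gw r T by auto
      ultimately show ?thesis by linarith
    qed
    ultimately show "norm (B r \<omega> - w r) \<le> \<epsilon>"
      using norm_triangle_ineq[of "B r \<omega> - u r" "u r - w r"] by simp
  qed
qed

end

section \<open>The chamber and the interaction gradient\<close>

text \<open>
  The gradient of \<open>interaction_potential\<close> on the chamber, in closed form: the pair \<open>(i, j)\<close> acts on
  coordinates \<open>i\<close> and \<open>j\<close> with opposite signs.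
\<close>

definition interaction_gradient :: "real \<Rightarrow> real ^ 'n::{finite,linorder} \<Rightarrow> real ^ 'n::{finite,linorder}" where
  "interaction_gradient \<gamma> a = (\<chi> k. - \<gamma> * (\<Sum>p\<in>{(i, j). i < j}.
     ((if k = snd p then 1 else 0) - (if k = fst p then 1 else 0)) / (a $ snd p - a $ fst p)))"

text \<open>
  The gradient paired with a direction \<open>h\<close> is the directional derivative of the interaction
  potential.
\<close>

lemma inner_interaction_gradient:
  fixes a h :: "real ^ 'n::{finite,linorder}"
  shows "interaction_gradient \<gamma> a \<bullet> h = - \<gamma> * (\<Sum>p\<in>{(i, j). i < j}. (h $ snd p - h $ fst p) / (a $ snd p - a $ fst p))"
proof -
  let ?P = "{(i, j). i < (j::'n::{finite,linorder})}"
  let ?D = "\<lambda>k p. (if k = snd p then 1 else 0) - (if k = fst p then 1 else (0::real))"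
  have D: "(\<Sum>k\<in>UNIV. ?D k p * h $ k) = h $ snd p - h $ fst p" for p
    by (simp add: left_diff_distrib sum_subtractf if_distrib[of "\<lambda>x. x * _"] cong: if_cong)
  have "interaction_gradient \<gamma> a \<bullet> h = (\<Sum>k\<in>UNIV. - \<gamma> * (\<Sum>p\<in>?P. ?D k p / (a $ snd p - a $ fst p)) * h $ k)"
    by (simp add: inner_vec_def interaction_gradient_def)
  also have "\<dots> = - \<gamma> * (\<Sum>k\<in>UNIV. \<Sum>p\<in>?P. ?D k p * h $ k / (a $ snd p - a $ fst p))"
    by (simp add: sum_distrib_left sum_distrib_right mult.assoc)
  also have "(\<Sum>k\<in>UNIV. \<Sum>p\<in>?P. ?D k p * h $ k / (a $ snd p - a $ fst p))
      = (\<Sum>p\<in>?P. (\<Sum>k\<in>UNIV. ?D k p * h $ k) / (a $ snd p - a $ fst p))"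
    by (subst sum.swap) (simp add: sum_divide_distrib)
  finally show ?thesis by (simp only: D)
qed

text \<open>
  Concavity of the logarithm: it lies below its tangents.
\<close>

lemma interaction_gradient_in_subdifferential_graph:
  fixes a :: "real ^ 'n::{finite,linorder}"
  assumes \<gamma>: "0 < \<gamma>" and a: "a \<in> chamber"
  shows "(a, interaction_gradient \<gamma> a) \<in> subdifferential_graph (interaction_potential \<gamma>)"
proof -
  let ?P = "{(i, j). i < (j::'n::{finite,linorder})}"
  have pot: "interaction_potential \<gamma> z = ereal (- \<gamma> * (\<Sum>p\<in>?P. ln (z $ snd p - z $ fst p)))"
    if "z \<in> chamber" for z :: "real ^ 'n::{finite,linorder}"
    using that by (simp add: interaction_potential_def case_prod_unfold)
  have "- \<gamma> * (\<Sum>p\<in>?P. ln (a $ snd p - a $ fst p)) + interaction_gradient \<gamma> a \<bullet> (z - a)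
      \<le> - \<gamma> * (\<Sum>p\<in>?P. ln (z $ snd p - z $ fst p))" if z: "z \<in> chamber" for z
  proof -
    have "ln (z $ snd p - z $ fst p) \<le> ln (a $ snd p - a $ fst p)
        + ((z - a) $ snd p - (z - a) $ fst p) / (a $ snd p - a $ fst p)" if p: "p \<in> ?P" for p
    proof -
      define s t where "s = a $ snd p - a $ fst p" and "t = z $ snd p - z $ fst p"
      have st: "0 < s" "0 < t" using a z p by (auto simp: chamber_def s_def t_def)
      then have "ln t - ln s \<le> t / s - 1" using ln_le_minus_one[of "t / s"] by (simp add: ln_div)
      also have "t / s - 1 = ((z - a) $ snd p - (z - a) $ fst p) / s"
        using st by (simp add: s_def t_def field_simps)
      finally show ?thesis by (simp add: s_def t_def)
    qed
    then have "(\<Sum>p\<in>?P. ln (z $ snd p - z $ fst p)) \<le> (\<Sum>p\<in>?P. ln (a $ snd p - a $ fst p))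
        + (\<Sum>p\<in>?P. ((z - a) $ snd p - (z - a) $ fst p) / (a $ snd p - a $ fst p))"
      by (subst sum.distrib[symmetric]) (rule sum_mono)
    from mult_left_mono[OF this less_imp_le[OF \<gamma>]] show ?thesis
      by (simp only: inner_interaction_gradient distrib_left mult_minus_left)
  qed
  then have "interaction_potential \<gamma> a + ereal (interaction_gradient \<gamma> a \<bullet> (z - a)) \<le> interaction_potential \<gamma> z" for z
    by (cases "z \<in> chamber") (simp_all add: pot a, simp add: interaction_potential_def)
  then show ?thesis
    by (simp add: subdifferential_graph_def subdifferential_def pot a)
qed

lemma continuous_on_interaction_gradient:
  "continuous_on chamber (interaction_gradient \<gamma> :: real ^ 'n::{finite,linorder} \<Rightarrow> real ^ 'n::{finite,linorder})"
  unfolding interaction_gradient_def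
  by (intro continuous_intros) (fastforce simp: chamber_def)

lemma convex_deriv_monotone:
  fixes v :: "real \<Rightarrow> real"
  assumes "convex_on UNIV v" "\<And>u. v differentiable (at u)"
  shows "0 \<le> (x - y) * (deriv v x - deriv v y)"
proof -
  have tangent: "deriv v b * (a - b) \<le> v a - v b" for a b
    using assms by (intro convex_on_imp_above_tangent[of UNIV]) (auto simp: DERIV_deriv_iff_real_differentiable)
  from tangent[of x y] tangent[of y x] show ?thesis by (simp add: algebra_simps)
qed

text \<open>
  In the closed chamber the inequalities between coordinates are weak; mixing in a point that
  satisfies them strictly makes them strict.
\<close>

lemma convex_chamber_segment:
  fixes x :: "real ^ 'n::{finite,linorder}"
  assumes x: "x \<in> closure chamber" and a: "a \<in> chamber" and s: "0 < s" "s \<le> 1"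
  shows "(1 - s) *\<^sub>R x + s *\<^sub>R a \<in> chamber"
proof -
  have "closed {z :: real ^ 'n::{finite,linorder}. \<forall>i j. i < j \<longrightarrow> z $ i \<le> z $ j}"
  proof -
    have "{z :: real ^ 'n::{finite,linorder}. \<forall>i j. i < j \<longrightarrow> z $ i \<le> z $ j} = (\<Inter>i. \<Inter>j\<in>{j. i < j}. {z. z $ i \<le> z $ j})" by auto
    also have "closed \<dots>" by (intro closed_INT ballI closed_Collect_le continuous_intros)
    finally show ?thesis .
  qed
  then have "closure chamber \<subseteq> {z :: real ^ 'n::{finite,linorder}. \<forall>i j. i < j \<longrightarrow> z $ i \<le> z $ j}"
    by (intro closure_minimal) (auto simp: chamber_def less_imp_le)
  then have x': "x $ i \<le> x $ j" if "i < j" for i j using x that by auto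
  have "(1 - s) * x $ i + s * a $ i < (1 - s) * x $ j + s * a $ j" if ij: "i < j" for i j
    using x'[OF ij] a ij s by (intro add_le_less_mono mult_left_mono mult_strict_left_mono) (auto simp: chamber_def)
  then show ?thesis by (simp add: chamber_def)
qed

lemma interior_access:
  fixes x :: "real ^ 'n::{finite,linorder}"
  assumes x: "x \<in> closure chamber" and W: "open W" "x \<in> W"
  obtains a where "a \<in> chamber" "closed_segment x a \<subseteq> W \<inter> closure chamber"
    "\<And>s. 0 < s \<Longrightarrow> s \<le> 1 \<Longrightarrow> (1 - s) *\<^sub>R x + s *\<^sub>R a \<in> chamber"
proof -
  obtain e where e: "e > 0" "ball x e \<subseteq> W" using W open_contains_ball by blast
  obtain a where a: "a \<in> chamber" "dist a x < e"
    using x e(1) unfolding closure_approachable by blast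
  have seg: "(1 - s) *\<^sub>R x + s *\<^sub>R a \<in> chamber" if "0 < s" "s \<le> 1" for s
    by (rule convex_chamber_segment[OF x a(1) that])
  have "closed_segment x a \<subseteq> ball x e"
    using e a by (intro closed_segment_subset) (auto simp: dist_commute)
  moreover have "closed_segment x a \<subseteq> closure chamber"
  proof
    fix z assume "z \<in> closed_segment x a"
    then obtain u where u: "0 \<le> u" "u \<le> 1" "z = (1 - u) *\<^sub>R x + u *\<^sub>R a" by (auto simp: closed_segment_def)
    then show "z \<in> closure chamber" using seg[of u] x closure_subset by (cases "u = 0") auto
  qed
  ultimately show ?thesis using that[OF a(1) _ seg] e by blast
qed

text \<open>
  The compact set \<open>C\<close> joins \<open>x\<close> to \<open>y\<close> inside \<open>U\<close>, meeting the boundary of the chamber at most at its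
  ends, and fixes the width \<open>2 d\<close> of the tube. Only then is the path cut off at distance at most \<open>d\<close>
  from \<open>x\<close> and \<open>y\<close>. Outside \<open>{0..T}\<close> it is constant.
\<close>

lemma tube_path:
  fixes U :: "(real ^ 'n::{finite,linorder}) set"
  assumes U: "openin (top_of_set (closure chamber)) U" and conn: "connected (chamber \<inter> U)"
    and x: "x \<in> U" and y: "y \<in> U" and T: "0 < T" and r: "0 < r"
  obtains \<alpha> :: "real \<Rightarrow> real ^ 'n::{finite,linorder}" and d where
    "0 < d" "continuous_on UNIV \<alpha>" "\<And>s. \<alpha> s \<in> \<alpha> ` {0..T}" "\<And>s. \<alpha> s \<in> chamber"
    "norm (x - \<alpha> 0) \<le> d"
    "\<And>s z. z \<in> closure chamber \<Longrightarrow> norm (z - \<alpha> s) < 2 * d \<Longrightarrow> z \<in> U"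
    "\<And>z. norm (z - \<alpha> T) < 2 * d \<Longrightarrow> norm (z - y) < r"
proof -
  obtain W where W: "open W" "U = closure chamber \<inter> W" using U by (auto simp: openin_open)
  have O_eq: "chamber \<inter> U = chamber \<inter> W" using W closure_subset by auto
  have xy: "x \<in> closure chamber" "x \<in> W" "y \<in> closure chamber" "y \<in> W" using x y W by auto
  obtain a where a: "a \<in> chamber" "closed_segment x a \<subseteq> W \<inter> closure chamber"
    "\<And>s. 0 < s \<Longrightarrow> s \<le> 1 \<Longrightarrow> (1 - s) *\<^sub>R x + s *\<^sub>R a \<in> chamber"
    using interior_access[OF xy(1) W(1) xy(2)] by blast
  obtain b where b: "b \<in> chamber" "closed_segment y b \<subseteq> W \<inter> closure chamber"
    "\<And>s. 0 < s \<Longrightarrow> s \<le> 1 \<Longrightarrow> (1 - s) *\<^sub>R y + s *\<^sub>R b \<in> chamber"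
    using interior_access[OF xy(3) W(1) xy(4)] by blast
  have "a \<in> chamber \<inter> W" "b \<in> chamber \<inter> W" using a b by auto
  moreover have "path_connected (chamber \<inter> W)"
    using connected_open_path_connected[of "chamber \<inter> W"] conn O_eq open_chamber W by auto
  ultimately obtain g where g: "path g" "path_image g \<subseteq> chamber \<inter> W" "pathstart g = a" "pathfinish g = b"
    unfolding path_connected_def by blast
  define C where "C = closed_segment x a \<union> path_image g \<union> closed_segment y b"
  have "compact C" unfolding C_def by (intro compact_Un compact_path_image g compact_segment)
  moreover have "C \<subseteq> W" using a b g by (auto simp: C_def)
  ultimately obtain e where e: "e > 0" "(\<Union>c\<in>C. ball c e) \<subseteq> W"
    using compact_subset_open_imp_ball_epsilon_subset[OF _ W(1)] by blast
  define d where "d = min (e / 2) (r / 4)"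
  have d: "0 < d" "2 * d \<le> e" "4 * d \<le> r" using e r by (auto simp: d_def)
  have near: "\<exists>s. 0 < s \<and> s \<le> 1 \<and> norm (p - ((1 - s) *\<^sub>R p + s *\<^sub>R q)) \<le> d" for p q :: "real ^ 'n::{finite,linorder}"
  proof -
    define s where "s = min 1 (d / (1 + norm (p - q)))"
    have s: "0 < s" "s \<le> 1" "s \<le> d / (1 + norm (p - q))" using d by (auto simp: s_def add_pos_nonneg)
    have "p - ((1 - s) *\<^sub>R p + s *\<^sub>R q) = s *\<^sub>R (p - q)" by (simp add: algebra_simps)
    then have "norm (p - ((1 - s) *\<^sub>R p + s *\<^sub>R q)) = s * norm (p - q)" using s by simp
    also have "\<dots> \<le> s * (1 + norm (p - q))" using s by (intro mult_left_mono) auto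
    also have "\<dots> \<le> d" using s(3) by (simp add: pos_le_divide_eq add_pos_nonneg)
    finally show ?thesis using s by blast
  qed
  obtain s where s: "0 < s" "s \<le> 1" "norm (x - ((1 - s) *\<^sub>R x + s *\<^sub>R a)) \<le> d" using near by blast
  obtain s' where s': "0 < s'" "s' \<le> 1" "norm (y - ((1 - s') *\<^sub>R y + s' *\<^sub>R b)) \<le> d" using near by blast
  define a' b' where "a' = (1 - s) *\<^sub>R x + s *\<^sub>R a" and "b' = (1 - s') *\<^sub>R y + s' *\<^sub>R b"
  have ab': "a' \<in> chamber" "b' \<in> chamber" "a' \<in> closed_segment x a" "b' \<in> closed_segment y b"
    using a(3)[of s] b(3)[of s'] s s' by (auto simp: a'_def b'_def closed_segment_def)
  define p where "p = linepath a' a +++ (g +++ linepath b b')"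
  have p: "path p" unfolding p_def using g by (intro path_join_imp) auto
  have convex: "convex (chamber :: (real ^ 'n::{finite,linorder}) set)"
    unfolding convex_alt
  proof (intro ballI allI impI)
    fix p q :: "real ^ 'n::{finite,linorder}" and u :: real
    assume "p \<in> chamber" "q \<in> chamber" "0 \<le> u \<and> u \<le> 1"
    then show "(1 - u) *\<^sub>R p + u *\<^sub>R q \<in> chamber"
      using convex_chamber_segment[of p q u] closure_subset[of chamber] by (cases "u = 0") auto
  qed
  have "path_image p = closed_segment a' a \<union> (path_image g \<union> closed_segment b b')"
    unfolding p_def using g by (simp add: path_image_join)
  then have p_img: "path_image p \<subseteq> chamber \<inter> C"
    using g ab' a(1) b(1) closed_segment_subset[OF _ _ convex, of a' a] closed_segment_subset[OF _ _ convex, of b b']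
      subset_closed_segment[of a' a x a] subset_closed_segment[of b b' y b]
    by (auto simp: C_def)
  define c where "c t = max 0 (min 1 (t / T))" for t
  define \<alpha> where "\<alpha> t = p (c t)" for t
  have c: "c t \<in> {0..1}" for t by (simp add: c_def)
  have c_cont: "continuous_on UNIV c" unfolding c_def by (intro continuous_intros) (use T in auto)
  have \<alpha>_p: "\<alpha> t \<in> path_image p" for t using c by (auto simp: \<alpha>_def path_image_def)
  have \<alpha>0: "\<alpha> 0 = a'" and \<alpha>T: "\<alpha> T = b'"
  proof -
    have "pathstart p = a'" "pathfinish p = b'" by (simp_all add: p_def)
    then show "\<alpha> 0 = a'" "\<alpha> T = b'" using T by (simp_all add: \<alpha>_def c_def pathstart_def pathfinish_def)
  qed
  show ?thesis
  proof (rule that[of d \<alpha>])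
    show "continuous_on UNIV \<alpha>"
      unfolding \<alpha>_def by (rule continuous_on_compose2[OF p[unfolded path_def] c_cont]) (use c in auto)
    show "\<alpha> t \<in> \<alpha> ` {0..T}" for t
    proof (rule image_eqI)
      show "\<alpha> t = \<alpha> (T * c t)" using T c[of t] by (simp add: \<alpha>_def c_def)
      show "T * c t \<in> {0..T}" using T c[of t] mult_left_mono[of "c t" 1 T] by auto
    qed
    show "\<alpha> t \<in> chamber" for t using \<alpha>_p p_img by auto
    show "norm (x - \<alpha> 0) \<le> d" using s by (simp add: \<alpha>0 a'_def)
    show "z \<in> U" if z: "z \<in> closure chamber" "norm (z - \<alpha> t) < 2 * d" for t z
    proof -
      have "z \<in> ball (\<alpha> t) e" using z d by (simp add: dist_norm norm_minus_commute)
      then have "z \<in> W" using e \<alpha>_p[of t] p_img by blast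
      then show ?thesis using z W by simp
    qed
    show "norm (z - y) < r" if z: "norm (z - \<alpha> T) < 2 * d" for z
    proof -
      have "norm (b' - y) \<le> d" using s' by (simp add: b'_def norm_minus_commute)
      then show ?thesis using z d norm_triangle_ineq[of "z - b'" "b' - y"] by (simp add: \<alpha>T)
    qed
  qed (use d in auto)
qed

section \<open>Survival in a relatively open set\<close>

text \<open>
  For a continuous path in \<open>S\<close> the set of times outside the relatively open \<open>U\<close> is closed, so a
  finite exit time is attained.
\<close>

lemma less_exit_time_iff:
  fixes \<xi> :: "real \<Rightarrow> 'a::t2_space"
  assumes \<xi>: "continuous_on {0..} \<xi>" "\<And>s. 0 \<le> s \<Longrightarrow> \<xi> s \<in> S"
    and U: "openin (top_of_set S) U" and t: "0 \<le> t"
  shows "ereal t < exit_time U \<xi> \<longleftrightarrow> (\<forall>s\<in>{0..t}. \<xi> s \<in> U)"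
proof
  assume less: "ereal t < exit_time U \<xi>"
  show "\<forall>s\<in>{0..t}. \<xi> s \<in> U"
  proof (rule ccontr)
    assume "\<not> (\<forall>s\<in>{0..t}. \<xi> s \<in> U)"
    then obtain s where "0 \<le> s" "s \<le> t" "\<xi> s \<notin> U" by auto
    then have "exit_time U \<xi> \<le> ereal s" unfolding exit_time_def by (intro Inf_lower) auto
    with less \<open>s \<le> t\<close> show False by (meson ereal_less_eq(3) leD order_trans)
  qed
next
  assume in_U: "\<forall>s\<in>{0..t}. \<xi> s \<in> U"
  let ?A = "{s. 0 \<le> s \<and> \<xi> s \<notin> U}"
  show "ereal t < exit_time U \<xi>"
  proof (cases "?A = {}")
    case True
    then show ?thesis unfolding exit_time_def by (simp only: True) (simp add: top_ereal_def)
  next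
    case False
    obtain W where W: "open W" "U = S \<inter> W" using U by (auto simp: openin_open)
    have "closed ({0..} \<inter> \<xi> -` (- W))"
      by (rule continuous_closed_preimage[OF \<xi>(1)]) (use W in auto)
    moreover have "{0..} \<inter> \<xi> -` (- W) = ?A" using W \<xi>(2) by auto
    ultimately have "closed ?A" by simp
    moreover have "bdd_below ?A" by (auto intro!: bdd_belowI[of _ 0])
    ultimately have "Inf ?A \<in> ?A" using False by (intro closed_contains_Inf)
    then have "t < Inf ?A" using in_U by (metis (mono_tags, lifting) atLeastAtMost_iff linorder_not_le mem_Collect_eq)
    also have "ereal (Inf ?A) \<le> exit_time U \<xi>"
      unfolding exit_time_def using \<open>bdd_below ?A\<close> by (intro Inf_greatest) (auto intro!: cInf_lower)
    finally show ?thesis by simp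
  qed
qed

text \<open>
  The survival event is an uncountable intersection. Up to a null set it says that, for some
  \<open>n\<close>, the path keeps a distance of at least \<open>1 / (n + 1)\<close> from the closed set \<open>S - U\<close> at all rational
  times before \<open>t\<close>; completeness absorbs the null set.
\<close>

lemma survival_measurable:
  fixes X :: "real \<Rightarrow> 'w \<Rightarrow> 'a::euclidean_space"
  assumes M: "complete_measure M" and X: "\<And>s. 0 \<le> s \<Longrightarrow> X s \<in> borel_measurable M"
    and cont: "AE \<omega> in M. continuous_on {0..} (\<lambda>s. X s \<omega>)"
    and S: "closed S" "AE \<omega> in M. \<forall>s\<ge>0. X s \<omega> \<in> S"
    and U: "openin (top_of_set S) U" and t: "0 < t" and G: "G \<in> sets borel"
  shows "{\<omega> \<in> space M. X t \<omega> \<in> G \<and> ereal t < exit_time U (\<lambda>s. X s \<omega>)} \<in> sets M"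
proof -
  interpret complete_measure M by fact
  obtain W where W: "open W" "U = S \<inter> W" using U by (auto simp: openin_open)
  define C where "C = S - W"
  have C: "closed C" unfolding C_def using S W by (intro closed_Diff)
  define Q where "Q = {0<..<t} \<inter> \<rat>"
  have Q: "countable Q" unfolding Q_def using countable_rat by (auto intro: countable_subset)
  have cl: "closure Q = {0..t}"
    unfolding Q_def using closure_open_Int_superset[of "{0<..<t}" \<rat>] t by (simp add: Rats_closure_real)
  define A where "A = {\<omega> \<in> space M. X t \<omega> \<in> G
      \<and> (C = {} \<or> (\<exists>n. \<forall>q\<in>Q. inverse (real (Suc n)) \<le> infdist (X q \<omega>) C))}"
  have A: "A \<in> sets M"
  proof -
    have "{\<omega> \<in> space M. X t \<omega> \<in> G} \<in> sets M"
      using measurable_sets[OF X G, of t] t by (simp add: vimage_def Int_def conj_commute)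
    moreover have "{\<omega> \<in> space M. C = {} \<or> (\<exists>n. \<forall>q\<in>Q. inverse (real (Suc n)) \<le> infdist (X q \<omega>) C)} \<in> sets M"
    proof (intro sets.sets_Collect_disj sets.sets_Collect_countable_Ex sets.sets_Collect_countable_All' Q)
      fix n q assume "q \<in> Q"
      then have "X q \<in> borel_measurable M" using X by (auto simp: Q_def)
      then have [measurable]: "(\<lambda>\<omega>. infdist (X q \<omega>) C) \<in> borel_measurable M"
        by (rule measurable_compose) (intro borel_measurable_continuous_onI continuous_intros)
      show "{\<omega> \<in> space M. inverse (real (Suc n)) \<le> infdist (X q \<omega>) C} \<in> sets M" by measurable
    qed auto
    ultimately show ?thesis unfolding A_def by (intro sets.sets_Collect_conj)
  qed
  have "AE \<omega> in M. \<omega> \<in> A \<longleftrightarrow> \<omega> \<in> {\<omega> \<in> space M. X t \<omega> \<in> G \<and> ereal t < exit_time U (\<lambda>s. X s \<omega>)}"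
    using cont S(2) AE_space
  proof eventually_elim
    case (elim \<omega>)
    have c: "continuous_on {0..t} (\<lambda>s. X s \<omega>)" using elim(1) by (rule continuous_on_subset) auto
    have "ereal t < exit_time U (\<lambda>s. X s \<omega>) \<longleftrightarrow> (\<forall>s\<in>{0..t}. X s \<omega> \<in> U)"
      using elim t by (intro less_exit_time_iff[OF _ _ U]) auto
    also have "\<dots> \<longleftrightarrow> (\<forall>s\<in>{0..t}. X s \<omega> \<notin> C)" using elim(2) W by (auto simp: C_def)
    also have "\<dots> \<longleftrightarrow> C = {} \<or> (\<exists>n. \<forall>q\<in>Q. inverse (real (Suc n)) \<le> infdist (X q \<omega>) C)"
    proof (cases "C = {}")
      case False
      have ci: "continuous_on {0..t} (\<lambda>s. infdist (X s \<omega>) C)" using c by (intro continuous_intros)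
      show ?thesis
      proof
        assume avoid: "\<forall>s\<in>{0..t}. X s \<omega> \<notin> C"
        obtain s where s: "s \<in> {0..t}" "\<And>q. q \<in> {0..t} \<Longrightarrow> infdist (X s \<omega>) C \<le> infdist (X q \<omega>) C"
          using continuous_attains_inf[OF compact_Icc _ ci] t by auto
        have "0 < infdist (X s \<omega>) C" by (rule infdist_pos_not_in_closed) (use C False avoid s in auto)
        then obtain n where "inverse (real (Suc n)) < infdist (X s \<omega>) C" using reals_Archimedean by blast
        moreover have "Q \<subseteq> {0..t}" by (auto simp: Q_def)
        ultimately have "\<forall>q\<in>Q. inverse (real (Suc n)) \<le> infdist (X q \<omega>) C" using s(2) by fastforce
        then show "C = {} \<or> (\<exists>n. \<forall>q\<in>Q. inverse (real (Suc n)) \<le> infdist (X q \<omega>) C)" by blast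
      next
        assume "C = {} \<or> (\<exists>n. \<forall>q\<in>Q. inverse (real (Suc n)) \<le> infdist (X q \<omega>) C)"
        then obtain n where n: "\<And>q. q \<in> Q \<Longrightarrow> inverse (real (Suc n)) \<le> infdist (X q \<omega>) C" using False by blast
        have "inverse (real (Suc n)) \<le> infdist (X s \<omega>) C" if "s \<in> {0..t}" for s
          by (rule continuous_ge_on_closure[of Q "\<lambda>s. infdist (X s \<omega>) C"]) (use ci cl that n in auto)
        then show "\<forall>s\<in>{0..t}. X s \<omega> \<notin> C" by (metis infdist_zero inverse_positive_iff_positive linorder_not_le of_nat_0_less_iff zero_less_Suc)
      qed
    qed simp
    finally show ?case using elim(3) by (simp add: A_def)
  qed
  then show ?thesis by (rule in_sets_AE) (use A in auto)
qed

section \<open>Tracking a path with positive probability\<close>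

text \<open>
  The test path must lie in the chamber and be continuous for every outcome, whereas
  \<open>\<alpha> + (B - w)\<close> does so only on the good event. Hence \<open>B - w\<close> is projected to a small ball,
  set to zero on a null set containing all outcomes with discontinuous \<open>B\<close>, and frozen after \<open>T\<close>.
\<close>

lemma dyson_tracks_path:
  fixes v :: "real \<Rightarrow> real" and M :: "'w measure"
    and B X K :: "real \<Rightarrow> 'w \<Rightarrow> real ^ 'n::{finite,linorder}"
    and \<alpha> :: "real \<Rightarrow> real ^ 'n::{finite,linorder}"
  assumes \<gamma>: "0 < \<gamma>"
    and v_diff: "\<And>u. v differentiable (at u)" and v'_cont: "continuous_on UNIV (deriv v)"
    and v_convex: "convex_on UNIV v"
    and M: "prob_space M" and F: "usual_filtration M F" and B: "brownian_motion M F B"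
    and sol: "generalized_dyson_solution v \<gamma> M F B x X K"
    and T: "0 < T" and d: "0 < d"
    and \<alpha>: "continuous_on UNIV \<alpha>" "\<And>s. \<alpha> s \<in> \<alpha> ` {0..T}" "\<And>s. \<alpha> s \<in> chamber"
    and start: "norm (x - \<alpha> 0) \<le> d"
  obtains E where "E \<in> sets M" "0 < measure M E"
    "AE \<omega> in M. \<omega> \<in> E \<longrightarrow> (\<forall>s\<in>{0..T}. norm (X s \<omega> - \<alpha> s) < 2 * d)"
proof -
  interpret brownian M F B by (intro brownian.intro brownian_axioms.intro M F B)
  define H where "H = (interaction_gradient \<gamma> :: real ^ 'n::{finite,linorder} \<Rightarrow> _)"
  define N where "N z = (\<chi> k. deriv v (z $ k))" for z :: "real ^ 'n::{finite,linorder}"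
  define J where "J a = N a + H a" for a
  have grad: "gradient (confining_potential v) = (N :: real ^ 'n::{finite,linorder} \<Rightarrow> _)"
    unfolding N_def by (rule ext, rule gradient_confining_potential[OF v_diff])
  have N_cont: "continuous_on S N" for S
    unfolding N_def
    by (intro continuous_intros continuous_on_compose2[OF v'_cont]) auto
  have N_mono: "0 \<le> (p - q) \<bullet> (N p - N q)" for p q
    unfolding inner_vec_def N_def
    by (intro sum_nonneg) (simp add: convex_deriv_monotone[OF v_convex v_diff])
  have H_cont: "continuous_on chamber H" unfolding H_def by (rule continuous_on_interaction_gradient)
  have J_cont: "continuous_on chamber J" unfolding J_def by (intro continuous_intros N_cont H_cont)

  have img: "compact (\<alpha> ` {0..T})" "\<alpha> ` {0..T} \<subseteq> chamber"
    using \<alpha> by (auto intro!: compact_continuous_image elim: continuous_on_subset)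
  obtain \<rho>0 where \<rho>0: "0 < \<rho>0" "(\<Union>c\<in>\<alpha> ` {0..T}. ball c \<rho>0) \<subseteq> chamber"
    using compact_subset_open_imp_ball_epsilon_subset[OF img(1) open_chamber img(2)] by blast
  define \<rho> where "\<rho> = \<rho>0 / 2"
  have \<rho>: "0 < \<rho>" using \<rho>0 by (simp add: \<rho>_def)
  define L where "L = {c + u | c u. c \<in> \<alpha> ` {0..T} \<and> u \<in> cball 0 \<rho>}"
  have L: "compact L" unfolding L_def by (intro compact_sums img compact_cball)
  have L_sub: "L \<subseteq> chamber"
  proof
    fix z assume "z \<in> L"
    then obtain c u where "z = c + u" "c \<in> \<alpha> ` {0..T}" "norm u \<le> \<rho>" by (auto simp: L_def)
    then have "z \<in> ball c \<rho>0" using \<rho>0 by (simp add: dist_norm \<rho>_def)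
    then show "z \<in> chamber" using \<rho>0 \<open>c \<in> \<alpha> ` {0..T}\<close> by blast
  qed
  have \<alpha>L: "\<alpha> s + u \<in> L" if "norm u \<le> \<rho>" for s u
    unfolding L_def using \<alpha>(2)[of s] that by auto
  \<comment> \<open>The comparison costs \<open>2 * T * e = d / 4\<close> and \<open>B - w\<close> at most another \<open>d / 4\<close>, within a tube of width \<open>2 * d\<close> of which the initial gap uses \<open>d\<close>.\<close>
  define e where "e = d / (8 * T)"
  have e: "0 < e" "2 * T * e = d / 4" using T d by (simp_all add: e_def)
  have "uniformly_continuous_on L J"
    using continuous_on_subset[OF J_cont L_sub] L by (rule compact_uniformly_continuous)
  then obtain \<eta> where \<eta>: "0 < \<eta>" "\<And>p q. p \<in> L \<Longrightarrow> q \<in> L \<Longrightarrow> dist p q < \<eta> \<Longrightarrow> dist (J p) (J q) < e"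
    unfolding uniformly_continuous_on_def using e(1) by metis
  define \<epsilon> where "\<epsilon> = min \<rho> (min (\<eta> / 2) (d / 4))"
  have \<epsilon>: "0 < \<epsilon>" "\<epsilon> \<le> \<rho>" "\<epsilon> < \<eta>" "\<epsilon> \<le> d / 4" using \<rho> \<eta> d by (auto simp: \<epsilon>_def)

  have J\<alpha>: "continuous_on {0..T} (\<lambda>s. J (\<alpha> s))"
    by (rule continuous_on_compose2[OF J_cont continuous_on_subset[OF \<alpha>(1)]]) (use \<alpha>(3) in auto)
  define w where "w s = \<alpha> s - \<alpha> 0 + integral {0..s} (\<lambda>r. J (\<alpha> r))" for s
  have w_cont: "continuous_on {0..T} w"
    unfolding w_def
    by (intro continuous_intros continuous_on_subset[OF \<alpha>(1)] indefinite_integral_continuous_1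
        integrable_continuous_interval J\<alpha>) auto
  obtain E where E: "E \<in> events" "0 < prob E"
    and E_near: "\<And>\<omega> r. \<omega> \<in> E \<Longrightarrow> continuous_on {0..} (\<lambda>t. B t \<omega>) \<Longrightarrow> r \<in> {0..T} \<Longrightarrow> norm (B r \<omega> - w r) \<le> \<epsilon>"
    using full_support[OF T w_cont _ \<epsilon>(1)] by (auto simp: w_def)

  have "AE \<omega> in M. continuous_on {0..} (\<lambda>t. B t \<omega>)" using B by (simp add: brownian_motion_def)
  then obtain Z where Z: "{\<omega> \<in> space M. \<not> continuous_on {0..} (\<lambda>t. B t \<omega>)} \<subseteq> Z" "Z \<in> null_sets M"
    by (rule AE_E) (simp add: null_sets_def)
  define c where "c = clip 0 T"
  have c: "c s \<in> {0..T}" for s using T by (simp add: c_def clip_def)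
  have c_id: "c s = s" if "s \<in> {0..T}" for s using that by (simp add: c_def clip_def)
  have c_cont: "continuous_on S c" for S unfolding c_def clip_def by (intro continuous_intros)
  let ?pr = "closest_point (cball (0 :: real ^ 'n::{finite,linorder}) \<rho>)"
  have pr_in: "norm (?pr u) \<le> \<rho>" for u
    using closest_point_in_set[of "cball 0 \<rho>" u] \<rho> by simp
  have pr_cont: "continuous_on S ?pr" for S
    using \<rho> by (intro continuous_on_closest_point) auto
  define \<kappa> where "\<kappa> s \<omega> = (if \<omega> \<in> Z then 0 else ?pr (B (c s) \<omega> - w (c s)))" for s \<omega>
  have \<kappa>_le: "norm (\<kappa> s \<omega>) \<le> \<rho>" for s \<omega> using pr_in \<rho> by (simp add: \<kappa>_def)
  \<comment> \<open>The indicator makes \<open>b\<close> measurable; it equals one, because \<open>a\<close> stays in the chamber.\<close>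
  define a b where "a s \<omega> = \<alpha> s + \<kappa> s \<omega>" and "b s \<omega> = indicator chamber (a s \<omega>) *\<^sub>R H (a s \<omega>)" for s \<omega>
  have a_L: "a s \<omega> \<in> L" for s \<omega> unfolding a_def by (rule \<alpha>L[OF \<kappa>_le])
  have b_eq: "b s \<omega> = H (a s \<omega>)" for s \<omega> using a_L[of s \<omega>] L_sub by (auto simp: b_def)
  have a_meas: "a s \<in> borel_measurable M" for s
  proof -
    have "(\<lambda>\<omega>. B (c s) \<omega> - w (c s)) \<in> borel_measurable M"
      using c[of s] by (intro borel_measurable_diff B_measurable) auto
    then have "(\<lambda>\<omega>. ?pr (B (c s) \<omega> - w (c s))) \<in> borel_measurable M"
      by (rule measurable_compose) (rule borel_measurable_continuous_onI[OF pr_cont])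
    moreover have "Z \<in> events" using Z by auto
    ultimately have "\<kappa> s \<in> borel_measurable M"
      unfolding \<kappa>_def by (intro measurable_If) auto
    then show ?thesis unfolding a_def by (intro borel_measurable_add) auto
  qed
  have b_meas: "b s \<in> borel_measurable M" for s
    unfolding b_def
    by (rule measurable_compose[OF a_meas])
      (intro borel_measurable_continuous_on_indicator H_cont borel_open open_chamber)
  have a_cont: "continuous_on {0..} (\<lambda>s. a s \<omega>)" if "\<omega> \<in> space M" for \<omega>
  proof (cases "\<omega> \<in> Z")
    case True
    then show ?thesis by (simp add: a_def \<kappa>_def continuous_on_subset[OF \<alpha>(1)])
  next
    case False
    then have Bc: "continuous_on {0..} (\<lambda>t. B t \<omega>)" using Z that by auto
    have "continuous_on {0..} (\<lambda>s. B (c s) \<omega>)"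
      by (rule continuous_on_compose2[OF Bc c_cont]) (use c in auto)
    moreover have "continuous_on {0..} (\<lambda>s. w (c s))"
      by (rule continuous_on_compose2[OF w_cont c_cont]) (use c in auto)
    ultimately have "continuous_on {0..} (\<lambda>s. ?pr (B (c s) \<omega> - w (c s)))"
      by (intro continuous_on_compose2[OF pr_cont[of UNIV]] continuous_intros) auto
    then show ?thesis
      using False by (simp add: a_def \<kappa>_def continuous_on_add continuous_on_subset[OF \<alpha>(1)])
  qed
  have b_cont: "continuous_on {0..} (\<lambda>s. b s \<omega>)" if "\<omega> \<in> space M" for \<omega>
    unfolding b_eq using a_L L_sub by (intro continuous_on_compose2[OF H_cont a_cont[OF that]]) auto
  have nonneg: "AE \<omega> in M. nonneg_on_half_line
      (pairing_measure (\<lambda>s. X s \<omega> - a s \<omega>) (\<lambda>s. K s \<omega>) (\<lambda>s. b s \<omega>))"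
  proof -
    have "(a s \<omega>, b s \<omega>) \<in> subdifferential_graph (interaction_potential \<gamma>)" for s \<omega>
      unfolding b_eq H_def
      by (rule interaction_gradient_in_subdifferential_graph[OF \<gamma>]) (use a_L L_sub in auto)
    then show ?thesis
      using sol a_meas b_meas a_cont b_cont unfolding generalized_dyson_solution_def by blast
  qed

  show ?thesis
  proof (rule that[OF E])
    have 1: "AE \<omega> in M. continuous_on {0..} (\<lambda>t. X t \<omega>) \<and> continuous_on {0..} (\<lambda>t. K t \<omega>)"
      and 2: "AE \<omega> in M. \<forall>t\<ge>0. X t \<omega> = x - integral {0..t} (\<lambda>s. N (X s \<omega>)) - K t \<omega> + B t \<omega>"
      and 3: "AE \<omega> in M. finite_variation (\<lambda>t. K t \<omega>) \<and> K 0 \<omega> = 0"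
      using sol unfolding generalized_dyson_solution_def grad by blast+
    have 4: "AE \<omega> in M. \<omega> \<notin> Z" using Z(2) by (rule AE_not_in)
    show "AE \<omega> in M. \<omega> \<in> E \<longrightarrow> (\<forall>s\<in>{0..T}. norm (X s \<omega> - \<alpha> s) < 2 * d)"
      using 1 2 3 4 nonneg AE_space
    proof eventually_elim
      case (elim \<omega>)
      note Xc = conjunct1[OF elim(1)] and Kc = conjunct2[OF elim(1)] and eq = elim(2)
      have Bc: "continuous_on {0..} (\<lambda>t. B t \<omega>)" using Z(1) elim(4,6) by blast
      show ?case
      proof (intro impI ballI)
        fix s assume \<omega>: "\<omega> \<in> E" and s: "s \<in> {0..T}"
        have near: "norm (B r \<omega> - w r) \<le> \<epsilon>" if "r \<in> {0..T}" for r by (rule E_near[OF \<omega> Bc that])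
        have \<kappa>_eq: "\<kappa> r \<omega> = B r \<omega> - w r" if "r \<in> {0..T}" for r
        proof -
          have "B r \<omega> - w r \<in> cball 0 \<rho>" using near[OF that] \<epsilon> by simp
          then show ?thesis using elim(4) that by (simp add: \<kappa>_def c_id closest_point_self)
        qed
        define f where "f r = N (X r \<omega>) - J (\<alpha> r)" for r
        have NX: "continuous_on {0..T} (\<lambda>r. N (X r \<omega>))"
          by (rule continuous_on_compose2[OF N_cont[of UNIV] continuous_on_subset[OF Xc]]) auto
        have f: "continuous_on {0..T} f" unfolding f_def by (intro continuous_intros NX J\<alpha>)
        \<comment> \<open>The noise cancels in \<open>X - a\<close>.\<close>
        have Zeq: "X r \<omega> - a r \<omega> = (x - \<alpha> 0) - K r \<omega> - integral {0..r} f" if r: "r \<in> {0..T}" for r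
        proof -
          have "integral {0..r} f = integral {0..r} (\<lambda>r. N (X r \<omega>)) - integral {0..r} (\<lambda>r. J (\<alpha> r))"
            unfolding f_def
            by (intro integral_diff integrable_continuous_interval continuous_on_subset[OF NX] continuous_on_subset[OF J\<alpha>])
              (use r in auto)
          moreover have "X r \<omega> = x - integral {0..r} (\<lambda>s. N (X s \<omega>)) - K r \<omega> + B r \<omega>" using eq r by auto
          ultimately show ?thesis by (simp add: a_def \<kappa>_eq[OF r] w_def)
        qed
        have "norm (X s \<omega> - a s \<omega>) \<le> norm (X 0 \<omega> - a 0 \<omega>) + 2 * T * e"
        proof (rule dissipative_comparison[where f = f and b = "\<lambda>r. b r \<omega>"])
          show "finite_variation (\<lambda>t. K t \<omega>)" "continuous_on {0..} (\<lambda>t. K t \<omega>)" using elim(3) Kc by auto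
          show "continuous_on {0..T} (\<lambda>r. b r \<omega>)"
            using b_cont[OF elim(6)] by (rule continuous_on_subset) auto
          show "nonneg_on_half_line (pairing_measure (\<lambda>r. X r \<omega> - a r \<omega>) (\<lambda>s. K s \<omega>) (\<lambda>r. b r \<omega>))"
            by (rule elim(5))
          fix r assume r: "r \<in> {0..T}"
          let ?z = "X r \<omega> - a r \<omega>"
          have "dist (J (a r \<omega>)) (J (\<alpha> r)) < e"
          proof (rule \<eta>(2))
            show "a r \<omega> \<in> L" by (rule a_L)
            show "\<alpha> r \<in> L" using \<alpha>L[of 0 r] \<rho> by simp
            show "dist (a r \<omega>) (\<alpha> r) < \<eta>" using near[OF r] \<epsilon> by (simp add: a_def \<kappa>_eq[OF r] dist_norm)
          qed
          then have "- e * norm ?z \<le> ?z \<bullet> (J (a r \<omega>) - J (\<alpha> r))"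
            using Cauchy_Schwarz_ineq2[of ?z "J (a r \<omega>) - J (\<alpha> r)"]
              mult_right_mono[of "norm (J (a r \<omega>) - J (\<alpha> r))" e "norm ?z"]
            by (simp add: dist_norm mult.commute)
          \<comment> \<open>Monotonicity of the confining drift.\<close>
          also have "\<dots> \<le> ?z \<bullet> (J (a r \<omega>) - J (\<alpha> r)) + ?z \<bullet> (N (X r \<omega>) - N (a r \<omega>))"
            using N_mono by simp
          also have "\<dots> = ?z \<bullet> (f r + b r \<omega>)"
            by (simp add: f_def b_eq J_def inner_add_right inner_diff_right)
          finally show "- e * norm ?z \<le> ?z \<bullet> (f r + b r \<omega>)" .
        qed (use T e f s Zeq in auto)
        also have "norm (X 0 \<omega> - a 0 \<omega>) \<le> d" using Zeq[of 0] T elim(3) start by simp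
        finally have "norm (X s \<omega> - a s \<omega>) \<le> d + d / 4" using e by simp
        moreover have "norm (a s \<omega> - \<alpha> s) \<le> d / 4" using near[OF s] \<epsilon> by (simp add: a_def \<kappa>_eq[OF s])
        ultimately show "norm (X s \<omega> - \<alpha> s) < 2 * d"
          using norm_triangle_ineq[of "X s \<omega> - a s \<omega>" "a s \<omega> - \<alpha> s"] d by simp
      qed
    qed
  qed
qed

theorem theorem5:
  fixes v :: "real \<Rightarrow> real"
    and \<gamma> :: real
    and M :: "'w measure"
    and F :: "real \<Rightarrow> 'w measure"
    and B :: "real \<Rightarrow> 'w \<Rightarrow> real ^ 'n::{finite,linorder}"
    and X K :: "real ^ 'n::{finite,linorder} \<Rightarrow> real \<Rightarrow> 'w \<Rightarrow> real ^ 'n::{finite,linorder}"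
    and U :: "(real ^ 'n::{finite,linorder}) set"
  assumes "0 < \<gamma>" and "\<gamma> < 1 / 2"
    and v_nonneg: "\<And>u. 0 \<le> v u"
    and v_smooth: "\<And>m u. (deriv ^^ m) v differentiable (at u)"
    and v_convex: "convex_on UNIV v"
    and v_lipschitz: "\<exists>L. L-lipschitz_on UNIV (deriv v)"
    and "prob_space M"
    and "usual_filtration M F"
    and "brownian_motion M F B"
    and solution: "\<And>x. x \<in> closure chamber \<Longrightarrow>
          generalized_dyson_solution v \<gamma> M F B x (X x) (K x)"
    and "U \<noteq> {}"
    and "openin (top_of_set (closure chamber)) U"
    and "connected (chamber \<inter> U)"
  shows "\<forall>t>0.
    topologically_irreducible (closure chamber) U (killed_semigroup M X U t) \<and>
    (\<forall>x\<in>U. \<forall>y\<in>U. \<forall>r>0.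
       0 < \<P>(\<omega> in M. X x t \<omega> \<in> ball y r \<inter> closure chamber \<and>
                     ereal t < exit_time U (\<lambda>s. X x s \<omega>)))"
proof -
  interpret prob_space M by fact
  interpret brownian M F B by (intro brownian.intro brownian_axioms.intro) fact+
  have v_diff: "v differentiable (at u)" for u using v_smooth[of 0 u] by simp
  have "deriv v differentiable (at u)" for u using v_smooth[of 1 u] by simp
  then have v'_cont: "continuous_on UNIV (deriv v)"
    by (intro continuous_at_imp_continuous_on ballI differentiable_imp_continuous_within)
  have U: "U \<subseteq> closure chamber" using assms(12) by (auto dest: openin_imp_subset)
  have main: "0 < prob {\<omega> \<in> space M. X x t \<omega> \<in> ball y r \<inter> closure chamber \<and>
                     ereal t < exit_time U (\<lambda>s. X x s \<omega>)}" (is "0 < prob ?A")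
    if t: "0 < t" and x: "x \<in> U" and y: "y \<in> U" and r: "0 < r" for t x y r
  proof -
    have sol: "generalized_dyson_solution v \<gamma> M F B x (X x) (K x)" using solution x U by auto
    have adapted: "\<And>s. 0 \<le> s \<Longrightarrow> X x s \<in> borel_measurable (F s)"
      and Xc: "AE \<omega> in M. continuous_on {0..} (\<lambda>s. X x s \<omega>)"
      and Xcl: "AE \<omega> in M. \<forall>s\<ge>0. X x s \<omega> \<in> closure chamber"
      using sol unfolding generalized_dyson_solution_def adapted_process_def by auto
    have "complete_measure M" using \<open>usual_filtration M F\<close> by (simp add: usual_filtration_def)
    then have A: "?A \<in> events"
      using measurable_from_subalg[OF subalgebra_F adapted] Xc Xcl assms(12) t
      by (intro survival_measurable[where S = "closure chamber"]) auto
    obtain \<alpha> :: "real \<Rightarrow> real ^ 'n::{finite,linorder}" and d where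
      d: "0 < d" and \<alpha>: "continuous_on UNIV \<alpha>" "\<And>s. \<alpha> s \<in> \<alpha> ` {0..t}" "\<And>s. \<alpha> s \<in> chamber"
      and start: "norm (x - \<alpha> 0) \<le> d"
      and tube: "\<And>s z. z \<in> closure chamber \<Longrightarrow> norm (z - \<alpha> s) < 2 * d \<Longrightarrow> z \<in> U"
      and fin: "\<And>z. norm (z - \<alpha> t) < 2 * d \<Longrightarrow> norm (z - y) < r"
      by (rule tube_path[OF assms(12,13) x y t r], rule that)
    obtain E where E: "E \<in> events" "0 < prob E"
      and track: "AE \<omega> in M. \<omega> \<in> E \<longrightarrow> (\<forall>s\<in>{0..t}. norm (X x s \<omega> - \<alpha> s) < 2 * d)"
      by (rule dyson_tracks_path[OF assms(1) v_diff v'_cont v_convex assms(7-9) sol t d \<alpha> start])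
    have "AE \<omega> in M. \<omega> \<in> E \<longrightarrow> \<omega> \<in> ?A"
      using track Xc Xcl AE_space
    proof eventually_elim
      case (elim \<omega>)
      show ?case
      proof
        assume "\<omega> \<in> E"
        with elim have close: "\<forall>s\<in>{0..t}. norm (X x s \<omega> - \<alpha> s) < 2 * d" by blast
        then have "\<forall>s\<in>{0..t}. X x s \<omega> \<in> U" using tube elim(3) by auto
        then have "ereal t < exit_time U (\<lambda>s. X x s \<omega>)"
          using less_exit_time_iff[OF elim(2) _ assms(12), of t] elim(3) t by auto
        moreover have "norm (X x t \<omega> - y) < r" using fin close t by auto
        ultimately show "\<omega> \<in> ?A" using elim(3,4) t by (auto simp: dist_norm norm_minus_commute)
      qed
    qed
    then have "prob E \<le> prob ?A" using A by (rule finite_measure_mono_AE)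
    then show ?thesis using E by simp
  qed
  have "killed_semigroup M X U t (indicator (ball y r \<inter> closure chamber)) x
      = prob {\<omega> \<in> space M. X x t \<omega> \<in> ball y r \<inter> closure chamber \<and> ereal t < exit_time U (\<lambda>s. X x s \<omega>)}"
    for t x y r
  proof -
    have "killed_semigroup M X U t (indicator (ball y r \<inter> closure chamber)) x
      = (LINT \<omega>|M. indicator {\<omega>. X x t \<omega> \<in> ball y r \<inter> closure chamber \<and> ereal t < exit_time U (\<lambda>s. X x s \<omega>)} \<omega>)"
      unfolding killed_semigroup_def by (intro Bochner_Integration.integral_cong refl) (auto simp: indicator_def)
    also have "\<dots> = prob ({\<omega>. X x t \<omega> \<in> ball y r \<inter> closure chamber \<and> ereal t < exit_time U (\<lambda>s. X x s \<omega>)} \<inter> space M)"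
      by (rule Bochner_Integration.integral_indicator)
    finally show ?thesis by (simp add: Int_def conj_commute)
  qed
  then show ?thesis using main by (simp add: topologically_irreducible_def)
qed

end
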